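(* Let $S$ be a surface with a smooth Riemannian metric $g$ and let $s_0\in S$. There exists a fractional-linear integral of the geodesic flow of $g$ in a neighborhood of $s_0$ if and only if some neighborhood of $s_0$ carries a geodesic Nakai 4-web.
   Context: Everything is local and smooth. Let $(x,y)$ be local coordinates on $S$ and $p,q$ the conjugate momenta on $T^*S$ with the symplectic form $dp\wedge dx+dq\wedge dy$. In conformal coordinates $g=\Lambda(x,y)(dx^2+dy^2)$ the geodesic flow is the Hamiltonian flow of $H=\dfrac{p^2+q^2}{2\Lambda}$. A fractional-linear integral is a function $$I=\frac{A(x,y)p+B(x,y)q}{C(x,y)p+E(x,y)q}$$ with smooth real functions $A,B,C,E$, with $AE-BC$ nowhere zero, such that the Poisson bracket $\{I,H\}$ vanishes identically wherever $Cp+Eq\neq 0$. A (planar) 4-web on an open set is a collection of four smooth foliations by curves that are pairwise transversal at every point. A Nakai 4-web is a 4-web such that the cross-ratio of the four directions tangent to the web leaves (four distinct points of the projectivized tangent space at each point) is constant, i.e. the same at all points. A web is geodesic if all its leaves are (unparametrized) geodesics of $g$. *)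

theory Defs
  imports "HOL-Analysis.Analysis"
begin

section \<open>Smooth maps\<close>

text \<open>These notions are meant for open sets \<open>S\<close>. All iterated directional derivatives are
  required to be Frechet differentiable, so that \<open>smooth_on\<close> is membership in the class of
  infinitely often continuously differentiable maps.\<close>

primrec Ck_on :: "nat \<Rightarrow> 'a::real_normed_vector set \<Rightarrow> ('a \<Rightarrow> 'b::real_normed_vector) \<Rightarrow> bool" where
  "Ck_on 0 S f \<longleftrightarrow> continuous_on S f"
| "Ck_on (Suc k) S f \<longleftrightarrow> (\<forall>x\<in>S. f differentiable (at x)) \<and>
     (\<forall>v. Ck_on k S (\<lambda>x. frechet_derivative f (at x) v))"

definition smooth_on :: "'a::real_normed_vector set \<Rightarrow> ('a \<Rightarrow> 'b::real_normed_vector) \<Rightarrow> bool" where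
  "smooth_on S f \<longleftrightarrow> (\<forall>k. Ck_on k S f)"

definition diffeo_on :: "'a::real_normed_vector set \<Rightarrow> ('a \<Rightarrow> 'b::real_normed_vector) \<Rightarrow> bool" where
  "diffeo_on V f \<longleftrightarrow> open V \<and> open (f ` V) \<and> inj_on f V \<and>
     smooth_on V f \<and> smooth_on (f ` V) (inv_into V f)"


section \<open>Surfaces with a Riemannian metric\<close>

text \<open>A chart is a pair of its domain and its coordinate map; only the values of the coordinate
  map on the domain matter.\<close>

type_synonym 'a chart = "'a set \<times> ('a \<Rightarrow> real^2)"

definition coords :: "'a chart \<Rightarrow> (real^2) set" where
  "coords c = snd c ` fst c"

definition transition :: "'a chart \<Rightarrow> 'a chart \<Rightarrow> real^2 \<Rightarrow> real^2" where
  "transition c d = snd d \<circ> inv_into (fst c) (snd c)"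

definition overlap :: "'a chart \<Rightarrow> 'a chart \<Rightarrow> (real^2) set" where
  "overlap c d = snd c ` (fst c \<inter> fst d)"

definition smooth_surface :: "'a topology \<Rightarrow> 'a chart set \<Rightarrow> bool" where
  "smooth_surface S \<A> \<longleftrightarrow>
     Hausdorff_space S \<and> second_countable S \<and>
     (\<Union>c\<in>\<A>. fst c) = topspace S \<and>
     (\<forall>c\<in>\<A>. openin S (fst c) \<and> open (coords c) \<and>
        homeomorphic_map (subtopology S (fst c)) (top_of_set (coords c)) (snd c)) \<and>
     (\<forall>c\<in>\<A>. \<forall>d\<in>\<A>. smooth_on (overlap c d) (transition c d))"

text \<open>A metric is given by its Gram matrix \<open>g c z\<close> at the point with coordinates \<open>z\<close> in each
  chart \<open>c\<close>, subject to the tensorial transformation rule.\<close>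

definition riemannian_metric_on :: "(real^2) set \<Rightarrow> (real^2 \<Rightarrow> real^2^2) \<Rightarrow> bool" where
  "riemannian_metric_on U g \<longleftrightarrow> smooth_on U g \<and>
     (\<forall>z\<in>U. transpose (g z) = g z \<and> (\<forall>v. v \<noteq> 0 \<longrightarrow> v \<bullet> (g z *v v) > 0))"

definition riemannian_metric :: "'a chart set \<Rightarrow> ('a chart \<Rightarrow> real^2 \<Rightarrow> real^2^2) \<Rightarrow> bool" where
  "riemannian_metric \<A> g \<longleftrightarrow>
     (\<forall>c\<in>\<A>. riemannian_metric_on (coords c) (g c)) \<and>
     (\<forall>c\<in>\<A>. \<forall>d\<in>\<A>. \<forall>z\<in>overlap c d.
        let J = matrix (frechet_derivative (transition c d) (at z))
        in g c z = transpose J ** g d (transition c d z) ** J)"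


section \<open>Geodesic flow and its fractional-linear integrals\<close>

text \<open>Points of the cotangent bundle over a chart are pairs \<open>(z, p)\<close> of coordinates and conjugate
  momenta. The sign convention of the bracket is such that \<open>poisson F H\<close> is the derivative of
  \<open>F\<close> along the Hamiltonian flow of \<open>H\<close>.\<close>

definition poisson ::
  "((real^2) \<times> (real^2) \<Rightarrow> real) \<Rightarrow> ((real^2) \<times> (real^2) \<Rightarrow> real) \<Rightarrow> (real^2) \<times> (real^2) \<Rightarrow> real" where
  "poisson F H w =
     (\<Sum>i\<in>UNIV. frechet_derivative F (at w) (axis i 1, 0) * frechet_derivative H (at w) (0, axis i 1)
            - frechet_derivative F (at w) (0, axis i 1) * frechet_derivative H (at w) (axis i 1, 0))"

text \<open>Half of the squared norm of the covector \<open>p\<close>, in arbitrary, not necessarily conformal,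
  coordinates.\<close>

definition geodesic_hamiltonian :: "(real^2 \<Rightarrow> real^2^2) \<Rightarrow> (real^2) \<times> (real^2) \<Rightarrow> real" where
  "geodesic_hamiltonian g = (\<lambda>(z, p). (p \<bullet> (matrix_inv (g z) *v p)) / 2)"

lemma geodesic_hamiltonian_conformal:
  assumes "g z = mat l" and "l \<noteq> 0"
  shows "geodesic_hamiltonian g (z, p) = ((p $ 1)\<^sup>2 + (p $ 2)\<^sup>2) / (2 * l)"
proof -
  have "mat l ** mat (1 / l) = (mat 1 :: real^2^2)" "mat (1 / l) ** mat l = (mat 1 :: real^2^2)"
    using assms(2) by (simp_all add: vec_eq_iff matrix_matrix_mult_def mat_def forall_2 sum_2)
  then have inv: "g z ** mat (1 / l) = mat 1" "mat (1 / l) ** g z = mat 1"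
    using assms(1) by simp_all
  then have "g z ** matrix_inv (g z) = mat 1 \<and> matrix_inv (g z) ** g z = mat 1"
    unfolding matrix_inv_def by (rule someI[where x = "mat (1 / l)", OF conjI])
  with inv have "matrix_inv (g z) = mat (1 / l)"
    by (metis matrix_mul_assoc matrix_mul_lid matrix_mul_rid)
  then show ?thesis
    using assms(2)
    by (simp add: geodesic_hamiltonian_def matrix_vector_mult_def mat_def inner_vec_def sum_2
        power2_eq_square field_simps)
qed

definition fractional_linear ::
  "(real^2 \<Rightarrow> real) \<Rightarrow> (real^2 \<Rightarrow> real) \<Rightarrow> (real^2 \<Rightarrow> real) \<Rightarrow> (real^2 \<Rightarrow> real) \<Rightarrow>
     (real^2) \<times> (real^2) \<Rightarrow> real" where
  "fractional_linear A B C E =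
     (\<lambda>(z, p). (A z * p $ 1 + B z * p $ 2) / (C z * p $ 1 + E z * p $ 2))"

definition fractional_linear_integral ::
  "(real^2) set \<Rightarrow> (real^2 \<Rightarrow> real^2^2) \<Rightarrow>
     (real^2 \<Rightarrow> real) \<Rightarrow> (real^2 \<Rightarrow> real) \<Rightarrow> (real^2 \<Rightarrow> real) \<Rightarrow> (real^2 \<Rightarrow> real) \<Rightarrow> bool" where
  "fractional_linear_integral W g A B C E \<longleftrightarrow>
     smooth_on W A \<and> smooth_on W B \<and> smooth_on W C \<and> smooth_on W E \<and>
     (\<forall>z\<in>W. A z * E z - B z * C z \<noteq> 0) \<and>
     (\<forall>z\<in>W. \<forall>p. C z * p $ 1 + E z * p $ 2 \<noteq> 0 \<longrightarrow>
        poisson (fractional_linear A B C E) (geodesic_hamiltonian g) (z, p) = 0)"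


section \<open>Geodesics\<close>

definition christoffel :: "(real^2 \<Rightarrow> real^2^2) \<Rightarrow> real^2 \<Rightarrow> 2 \<Rightarrow> 2 \<Rightarrow> 2 \<Rightarrow> real" where
  "christoffel g z k i j =
     (let dg = (\<lambda>a b c. frechet_derivative (\<lambda>u. g u $ b $ c) (at z) (axis a 1))
      in (\<Sum>l\<in>UNIV. matrix_inv (g z) $ k $ l * (dg i j l + dg j i l - dg l i j)) / 2)"

definition velocity :: "(real \<Rightarrow> real^2) \<Rightarrow> real \<Rightarrow> real^2" where
  "velocity \<gamma> t = vector_derivative \<gamma> (at t)"

text \<open>Constant curves are excluded.\<close>

definition geodesic_on :: "real set \<Rightarrow> (real^2 \<Rightarrow> real^2^2) \<Rightarrow> (real \<Rightarrow> real^2) \<Rightarrow> bool" where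
  "geodesic_on T g \<gamma> \<longleftrightarrow> smooth_on T \<gamma> \<and>
     (\<forall>t\<in>T. velocity \<gamma> t \<noteq> 0 \<and>
        (\<forall>k. velocity (velocity \<gamma>) t $ k +
           (\<Sum>i\<in>UNIV. \<Sum>j\<in>UNIV. christoffel g (\<gamma> t) k i j * velocity \<gamma> t $ i * velocity \<gamma> t $ j) = 0))"


section \<open>Foliations and webs\<close>

text \<open>A foliation of \<open>W\<close> by curves is the partition of \<open>W\<close> into its leaves. In a foliated chart
  \<open>\<phi> : V \<rightarrow> (a\<^sub>1, b\<^sub>1) \<times> (a\<^sub>2, b\<^sub>2)\<close> the plaques are the level sets of the second component.
  A leaf may meet \<open>V\<close> in many plaques, possibly accumulating in \<open>V\<close>; the plaques are the path
  components of that intersection.\<close>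

definition foliation :: "(real^2) set \<Rightarrow> (real^2) set set \<Rightarrow> bool" where
  "foliation W \<F> \<longleftrightarrow> open W \<and> partition_on W \<F> \<and> (\<forall>L\<in>\<F>. path_connected L) \<and>
     (\<forall>z\<in>W. \<exists>V (\<phi> :: real^2 \<Rightarrow> real^2) a b.
        z \<in> V \<and> V \<subseteq> W \<and> diffeo_on V \<phi> \<and> \<phi> ` V = box a b \<and>
        (\<forall>L\<in>\<F>. \<forall>x\<in>L \<inter> V. path_component_set (L \<inter> V) x = {y\<in>V. \<phi> y $ 2 = \<phi> x $ 2}))"

definition leaf_tangent :: "(real^2) set set \<Rightarrow> real^2 \<Rightarrow> (real^2) set" where
  "leaf_tangent \<F> z = {v. \<exists>L\<in>\<F>. \<exists>\<gamma> e. e > 0 \<and> smooth_on {-e<..<e} \<gamma> \<and> \<gamma> ` {-e<..<e} \<subseteq> L \<and>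
     \<gamma> 0 = z \<and> velocity \<gamma> 0 = v}"

text \<open>Being a geodesic is a local property of a leaf: each of its points has a neighbourhood in the
  leaf that is the image of a geodesic. The leaf being one-dimensional, it is enough to ask for a
  geodesic through the point that stays in the leaf.\<close>

definition geodesic_leaf :: "(real^2 \<Rightarrow> real^2^2) \<Rightarrow> (real^2) set \<Rightarrow> bool" where
  "geodesic_leaf g L \<longleftrightarrow>
     (\<forall>z\<in>L. \<exists>\<gamma> e. e > 0 \<and> geodesic_on {-e<..<e} g \<gamma> \<and> \<gamma> ` {-e<..<e} \<subseteq> L \<and> \<gamma> 0 = z)"

definition four_web :: "(real^2) set \<Rightarrow> (nat \<Rightarrow> (real^2) set set) \<Rightarrow> bool" where
  "four_web W \<F> \<longleftrightarrow> (\<forall>i\<in>{1..4}. foliation W (\<F> i)) \<and>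
     (\<forall>z\<in>W. \<forall>i\<in>{1..4}. \<forall>j\<in>{1..4}. i \<noteq> j \<longrightarrow> leaf_tangent (\<F> i) z \<inter> leaf_tangent (\<F> j) z = {0})"

definition wedge :: "real^2 \<Rightarrow> real^2 \<Rightarrow> real" where
  "wedge v w = v $ 1 * w $ 2 - v $ 2 * w $ 1"

text \<open>Cross-ratio of the four points of the projective line spanned by nonzero vectors; it does not
  change when the vectors are rescaled.\<close>

definition cross_ratio :: "real^2 \<Rightarrow> real^2 \<Rightarrow> real^2 \<Rightarrow> real^2 \<Rightarrow> real" where
  "cross_ratio v1 v2 v3 v4 = (wedge v1 v3 * wedge v2 v4) / (wedge v1 v4 * wedge v2 v3)"

lemma cross_ratio_scale:
  assumes "a \<noteq> 0" "b \<noteq> 0" "c \<noteq> 0" "d \<noteq> 0"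
  shows "cross_ratio (a *\<^sub>R v1) (b *\<^sub>R v2) (c *\<^sub>R v3) (d *\<^sub>R v4) = cross_ratio v1 v2 v3 v4"
proof -
  have w: "wedge (s *\<^sub>R v) (t *\<^sub>R w) = (s * t) * wedge v w" for s t v w
    by (simp add: wedge_def algebra_simps)
  have "cross_ratio (a *\<^sub>R v1) (b *\<^sub>R v2) (c *\<^sub>R v3) (d *\<^sub>R v4) =
      ((a * b * c * d) * (wedge v1 v3 * wedge v2 v4)) /
      ((a * b * c * d) * (wedge v1 v4 * wedge v2 v3))"
    by (simp add: cross_ratio_def w mult_ac)
  then show ?thesis
    using assms by (simp add: cross_ratio_def)
qed

definition nakai_web :: "(real^2) set \<Rightarrow> (nat \<Rightarrow> (real^2) set set) \<Rightarrow> bool" where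
  "nakai_web W \<F> \<longleftrightarrow> four_web W \<F> \<and>
     (\<exists>r. \<forall>z\<in>W. \<forall>v. (\<forall>i\<in>{1..4}. v i \<in> leaf_tangent (\<F> i) z - {0}) \<longrightarrow>
        cross_ratio (v 1) (v 2) (v 3) (v 4) = r)"

definition geodesic_web :: "(real^2 \<Rightarrow> real^2^2) \<Rightarrow> (nat \<Rightarrow> (real^2) set set) \<Rightarrow> bool" where
  "geodesic_web g \<F> \<longleftrightarrow> (\<forall>i\<in>{1..4}. \<forall>L\<in>\<F> i. geodesic_leaf g L)"


section \<open>Existence near a point\<close>

text \<open>Neighbourhoods may be shrunk, so it suffices to consider those inside the domain of a
  chart, described in coordinates.\<close>

definition coord_nbhd :: "'a chart \<Rightarrow> 'a \<Rightarrow> (real^2) set \<Rightarrow> bool" where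
  "coord_nbhd c s W \<longleftrightarrow> s \<in> fst c \<and> open W \<and> W \<subseteq> coords c \<and> snd c s \<in> W"

definition has_fractional_linear_integral_near ::
  "'a chart set \<Rightarrow> ('a chart \<Rightarrow> real^2 \<Rightarrow> real^2^2) \<Rightarrow> 'a \<Rightarrow> bool" where
  "has_fractional_linear_integral_near \<A> g s \<longleftrightarrow>
     (\<exists>c\<in>\<A>. \<exists>W. coord_nbhd c s W \<and> (\<exists>A B C E. fractional_linear_integral W (g c) A B C E))"

definition has_geodesic_nakai_web_near ::
  "'a chart set \<Rightarrow> ('a chart \<Rightarrow> real^2 \<Rightarrow> real^2^2) \<Rightarrow> 'a \<Rightarrow> bool" where
  "has_geodesic_nakai_web_near \<A> g s \<longleftrightarrow>
     (\<exists>c\<in>\<A>. \<exists>W. coord_nbhd c s W \<and> (\<exists>\<F>. nakai_web W \<F> \<and> geodesic_web (g c) \<F>))"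

end

theory Submission
  imports Defs
begin

text \<open>
  Everything happens in the domain \<open>W\<close> of one coordinate system, so both directions are statements
  about a metric on an open subset of the plane.

  \<^emph>\<open>From a web to an integral.\<close> Let \<open>a\<^sub>1, \<dots>, a\<^sub>4\<close> be covector fields metrically dual to vector fields
  tangent to the four foliations. There is a unique projective coordinate \<open>I = N / M\<close> on the covectors at
  a point that takes the values \<open>0\<close>, \<open>\<infinity>\<close>, \<open>1\<close> at \<open>a\<^sub>1, a\<^sub>2, a\<^sub>3\<close>, and its value at \<open>a\<^sub>4\<close> is determined by the
  cross-ratio, hence constant. So \<open>I\<close> is constant along every leaf geodesic, which says that the cubic
  form \<open>{N,H} M - N {M,H}\<close> vanishes at the four directions of the web. A binary cubic form with four zeros
  on the projective line is zero, so \<open>I\<close> is an integral.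

  \<^emph>\<open>From an integral to a web.\<close> The level \<open>I = - r\<close> is spanned by a covector field \<open>a + r c\<close>, where \<open>a\<close> and
  \<open>c\<close> do not depend on the real parameter \<open>r\<close>. Directions with four constant parameters have constant
  cross-ratio, so the point is that the field of directions dual to \<open>a + r c\<close> integrates to a foliation by
  geodesics. The Poisson condition on this level says precisely that the normalized form
  \<open>\<alpha>\<^sub>r = (a + r c) / |a + r c|\<close> is closed. A potential \<open>u\<^sub>r\<close> of it thus has a gradient of length one: the
  \<open>u\<^sub>r\<close> form a complete integral of the Hamilton--Jacobi equation. By Jacobi's theorem \<open>\<partial>u\<^sub>r / \<partial>r\<close> is then
  constant along the gradient lines of \<open>u\<^sub>r\<close>; concretely, \<open>\<beta>\<^sub>r = \<partial>\<alpha>\<^sub>r / \<partial>r\<close> is closed, and orthogonal to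
  \<open>\<alpha>\<^sub>r\<close> because \<open>\<alpha>\<^sub>r\<close> is a unit form. With potentials \<open>u\<close> and \<open>w\<close> of \<open>\<alpha>\<^sub>r\<close> and \<open>\<beta>\<^sub>r\<close>, the map \<open>(u, w)\<close>
  is a foliated chart near every point: the leaves are the level curves of \<open>w\<close>, and \<open>u\<close> is arc length on
  them. Only the Poincare lemma and the inverse function theorem enter; no differential equation has to be
  solved.

  The two directions are the lemmas \<open>integral_of_web\<close> and \<open>web_of_integral\<close>. The second one rests on
  \<open>integral_pencil\<close> (the Poisson condition as closedness), \<open>curl_normalized_deriv\<close> (the second closed
  form), \<open>pencil_foliation\<close> (the foliation) and \<open>unit_closed_geodesic\<close> (its leaves are geodesics).
\<close>

section \<open>Calculus of smooth maps\<close>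

text \<open>\<open>Ck_on\<close> speaks of two-sided derivatives at the points of \<open>S\<close>; on an open set they depend only on
  the values there.\<close>

lemma Ck_on_cong:
  assumes "open S" and "\<And>x. x \<in> S \<Longrightarrow> f x = g x" and "Ck_on k S f"
  shows "Ck_on k S g"
  using assms(2,3)
proof (induction k arbitrary: f g)
  case 0
  then show ?case
    using continuous_on_cong by fastforce
next
  case (Suc k)
  have g: "(g has_derivative frechet_derivative f (at x)) (at x)" if "x \<in> S" for x
  proof -
    have "(f has_derivative frechet_derivative f (at x)) (at x)"
      using Suc.prems(2) that frechet_derivative_works by auto
    then show ?thesis
      using has_derivative_transform_within_open[OF _ \<open>open S\<close> that] Suc.prems(1) by blast
  qed
  have "Ck_on k S (\<lambda>x. frechet_derivative g (at x) v)" for v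
    by (rule Suc.IH[where f = "\<lambda>x. frechet_derivative f (at x) v"])
      (use Suc.prems(2) in \<open>auto simp: frechet_derivative_at[OF g]\<close>)
  then show ?case
    using g by (auto simp: differentiable_def)
qed

text \<open>In the inductions below, the derivative is known by an explicit formula rather than as a
  \<open>frechet_derivative\<close>.\<close>

lemma Ck_on_Suc_has_derivative:
  assumes "open S" and f: "\<And>x. x \<in> S \<Longrightarrow> (f has_derivative f' x) (at x)"
    and "\<And>v. Ck_on k S (\<lambda>x. f' x v)"
  shows "Ck_on (Suc k) S f"
proof -
  have "Ck_on k S (\<lambda>x. frechet_derivative f (at x) v)" for v
    by (rule Ck_on_cong[OF \<open>open S\<close> _ assms(3)[of v]]) (simp add: frechet_derivative_at[OF f, symmetric])
  then show ?thesis
    using f by (auto simp: differentiable_def)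
qed

lemma Ck_on_Suc_frechet:
  assumes "Ck_on (Suc k) S f" "x \<in> S"
  shows "(f has_derivative frechet_derivative f (at x)) (at x)"
  using assms frechet_derivative_works by auto

lemma Ck_on_SucD: "Ck_on (Suc k) S f \<Longrightarrow> Ck_on k S f"
proof (induction k arbitrary: f)
  case 0
  then show ?case
    by (auto intro!: continuous_at_imp_continuous_on differentiable_imp_continuous_within)
next
  case (Suc k)
  have "Ck_on k S (\<lambda>x. frechet_derivative f (at x) v)" for v
    using Suc.prems by (intro Suc.IH) (simp only: Ck_on.simps(2)[of "Suc k"])
  then show ?case
    using Suc.prems by simp
qed

lemma Ck_on_subset: "Ck_on k S f \<Longrightarrow> T \<subseteq> S \<Longrightarrow> Ck_on k T f"
  by (induction k arbitrary: f) (auto intro: continuous_on_subset)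

lemma Ck_on_const: "Ck_on k S (\<lambda>x. c)"
proof (induction k arbitrary: c)
  case (Suc k)
  then show ?case
    by (simp add: frechet_derivative_const)
qed simp

lemma Ck_on_linear:
  assumes "open S" "bounded_linear L" "Ck_on k S f"
  shows "Ck_on k S (\<lambda>x. L (f x))"
  using assms(3)
proof (induction k arbitrary: f)
  case 0
  then show ?case
    using assms(2) by (simp add: bounded_linear.continuous_on)
next
  case (Suc k)
  show ?case
  proof (rule Ck_on_Suc_has_derivative[OF \<open>open S\<close>])
    show "((\<lambda>x. L (f x)) has_derivative (\<lambda>v. L (frechet_derivative f (at x) v))) (at x)" if "x \<in> S" for x
      using Ck_on_Suc_frechet[OF Suc.prems that] assms(2) by (rule bounded_linear.has_derivative[rotated])
    show "Ck_on k S (\<lambda>x. L (frechet_derivative f (at x) v))" for v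
      using Suc by simp
  qed
qed

lemma Ck_on_add:
  assumes "open S" "Ck_on k S f" "Ck_on k S g"
  shows "Ck_on k S (\<lambda>x. f x + g x)"
  using assms(2,3)
proof (induction k arbitrary: f g)
  case 0
  then show ?case
    by (simp add: continuous_on_add)
next
  case (Suc k)
  show ?case
  proof (rule Ck_on_Suc_has_derivative[OF \<open>open S\<close>])
    show "((\<lambda>x. f x + g x) has_derivative
        (\<lambda>v. frechet_derivative f (at x) v + frechet_derivative g (at x) v)) (at x)" if "x \<in> S" for x
      by (rule has_derivative_add[OF Ck_on_Suc_frechet[OF Suc.prems(1) that]
            Ck_on_Suc_frechet[OF Suc.prems(2) that]])
    show "Ck_on k S (\<lambda>x. frechet_derivative f (at x) v + frechet_derivative g (at x) v)" for v
      using Suc.prems by (intro Suc.IH) simp_all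
  qed
qed

lemma Ck_on_bilinear:
  assumes "open S" "bounded_bilinear mul" "Ck_on k S f" "Ck_on k S g"
  shows "Ck_on k S (\<lambda>x. mul (f x) (g x))"
  using assms(3,4)
proof (induction k arbitrary: f g)
  case 0
  then show ?case
    using assms(2) by (simp add: bounded_bilinear.continuous_on)
next
  case (Suc k)
  show ?case
  proof (rule Ck_on_Suc_has_derivative[OF \<open>open S\<close>])
    show "((\<lambda>x. mul (f x) (g x)) has_derivative
        (\<lambda>v. mul (f x) (frechet_derivative g (at x) v) + mul (frechet_derivative f (at x) v) (g x))) (at x)"
      if "x \<in> S" for x
      by (rule bounded_bilinear.FDERIV[OF assms(2) Ck_on_Suc_frechet[OF Suc.prems(1) that]
            Ck_on_Suc_frechet[OF Suc.prems(2) that]])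
    show "Ck_on k S (\<lambda>x. mul (f x) (frechet_derivative g (at x) v) + mul (frechet_derivative f (at x) v) (g x))" for v
      using Suc.prems Suc.prems[THEN Ck_on_SucD] by (intro Ck_on_add \<open>open S\<close> Suc.IH) simp_all
  qed
qed

lemma Ck_on_sum:
  assumes "open S" "finite I" "\<And>i. i \<in> I \<Longrightarrow> Ck_on k S (f i)"
  shows "Ck_on k S (\<lambda>x. \<Sum>i\<in>I. f i x)"
  using assms(2,3)
  by (induction I rule: finite_induct) (auto intro!: Ck_on_add Ck_on_const \<open>open S\<close>)

text \<open>The derivative \<open>x \<mapsto> Df(g x)(Dg(x) v)\<close> is not itself a composition, but expanding \<open>Dg(x) v\<close> in a basis
  makes it a finite sum of products of functions covered by the induction hypothesis.\<close>

lemma Ck_on_compose: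
  fixes f :: "'b::euclidean_space \<Rightarrow> 'c::real_normed_vector" and g :: "'a::real_normed_vector \<Rightarrow> 'b"
  assumes "open S" "g ` S \<subseteq> T" "Ck_on k T f" "Ck_on k S g"
  shows "Ck_on k S (\<lambda>x. f (g x))"
  using assms(3,4)
proof (induction k arbitrary: f)
  case 0
  then show ?case
    using assms(2) by (auto intro: continuous_on_compose2)
next
  case (Suc k)
  define f' where "f' = (\<lambda>y. frechet_derivative f (at y))"
  have f': "(f has_derivative f' (g x)) (at (g x))" if "x \<in> S" for x
    unfolding f'_def using Ck_on_Suc_frechet[OF Suc.prems(1)] that assms(2) by blast
  have expand: "f' (g x) w = (\<Sum>b\<in>Basis. (w \<bullet> b) *\<^sub>R f' (g x) b)" if "x \<in> S" for x w
  proof -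
    interpret linear "f' (g x)"
      using f'[OF that] has_derivative_linear by blast
    have "f' (g x) w = f' (g x) (\<Sum>b\<in>Basis. (w \<bullet> b) *\<^sub>R b)"
      by (simp add: euclidean_representation)
    then show ?thesis
      by (simp add: sum scaleR)
  qed
  show ?case
  proof (rule Ck_on_Suc_has_derivative[OF \<open>open S\<close>])
    show "((\<lambda>x. f (g x)) has_derivative
        (\<lambda>v. \<Sum>b\<in>Basis. (frechet_derivative g (at x) v \<bullet> b) *\<^sub>R f' (g x) b)) (at x)" if "x \<in> S" for x
      by (rule has_derivative_eq_rhs[OF has_derivative_compose[OF Ck_on_Suc_frechet[OF Suc.prems(2) that]
              f'[OF that]]]) (rule ext, rule expand[OF that])
    show "Ck_on k S (\<lambda>x. \<Sum>b\<in>Basis. (frechet_derivative g (at x) v \<bullet> b) *\<^sub>R f' (g x) b)" for v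
    proof (intro Ck_on_sum \<open>open S\<close> finite_Basis Ck_on_bilinear[OF _ bounded_bilinear_scaleR])
      fix b :: 'b
      show "Ck_on k S (\<lambda>x. frechet_derivative g (at x) v \<bullet> b)"
        using Suc.prems(2) by (intro Ck_on_linear[OF \<open>open S\<close> bounded_linear_inner_left]) simp
      show "Ck_on k S (\<lambda>x. f' (g x) b)"
        using Suc.prems Ck_on_SucD unfolding f'_def by (intro Suc.IH) auto
    qed
  qed
qed

text \<open>All real exponents are treated at once because the derivative lowers the exponent. Reciprocals and
  square roots of positive functions are special cases.\<close>

lemma Ck_on_powr: "Ck_on k {0<..} (\<lambda>x::real. x powr s)"
proof (induction k arbitrary: s)
  case 0
  then show ?case
    by (auto intro!: continuous_intros)
next
  case (Suc k)
  show ?case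
  proof (rule Ck_on_Suc_has_derivative)
    show "((\<lambda>x. x powr s) has_derivative (\<lambda>v. (v * s) * x powr (s - 1))) (at x)" if "x \<in> {0<..}" for x :: real
      by (rule has_derivative_eq_rhs[OF has_field_derivative_imp_has_derivative[OF has_real_derivative_powr]])
        (use that in \<open>auto simp: mult_ac\<close>)
    show "Ck_on k {0<..} (\<lambda>x::real. (v * s) * x powr (s - 1))" for v
      by (intro Ck_on_bilinear[OF _ bounded_bilinear_mult] Ck_on_const Suc) auto
  qed auto
qed

lemma smooth_on_cong: "open S \<Longrightarrow> (\<And>x. x \<in> S \<Longrightarrow> f x = g x) \<Longrightarrow> smooth_on S f \<Longrightarrow> smooth_on S g"
  unfolding smooth_on_def using Ck_on_cong by blast

lemma smooth_on_subset: "smooth_on S f \<Longrightarrow> T \<subseteq> S \<Longrightarrow> smooth_on T f"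
  unfolding smooth_on_def using Ck_on_subset by blast

lemma smooth_on_const: "smooth_on S (\<lambda>x. c)"
  unfolding smooth_on_def using Ck_on_const by blast

lemma smooth_on_linear:
  "open S \<Longrightarrow> bounded_linear L \<Longrightarrow> smooth_on S f \<Longrightarrow> smooth_on S (\<lambda>x. L (f x))"
  unfolding smooth_on_def using Ck_on_linear by blast

lemma smooth_on_add: "open S \<Longrightarrow> smooth_on S f \<Longrightarrow> smooth_on S g \<Longrightarrow> smooth_on S (\<lambda>x. f x + g x)"
  unfolding smooth_on_def using Ck_on_add by blast

lemma smooth_on_minus: "open S \<Longrightarrow> smooth_on S f \<Longrightarrow> smooth_on S (\<lambda>x. - f x)"
  by (rule smooth_on_linear[OF _ bounded_linear_minus[OF bounded_linear_ident]])

lemma smooth_on_diff: "open S \<Longrightarrow> smooth_on S f \<Longrightarrow> smooth_on S g \<Longrightarrow> smooth_on S (\<lambda>x. f x - g x)"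
  using smooth_on_add[of S f "\<lambda>x. - g x"] smooth_on_minus[of S g] by simp

lemma smooth_on_mult:
  fixes f g :: "'a::real_normed_vector \<Rightarrow> real"
  shows "open S \<Longrightarrow> smooth_on S f \<Longrightarrow> smooth_on S g \<Longrightarrow> smooth_on S (\<lambda>x. f x * g x)"
  unfolding smooth_on_def using Ck_on_bilinear[OF _ bounded_bilinear_mult] by blast

lemma smooth_on_scaleR:
  "open S \<Longrightarrow> smooth_on S f \<Longrightarrow> smooth_on S g \<Longrightarrow> smooth_on S (\<lambda>x. f x *\<^sub>R g x)"
  unfolding smooth_on_def using Ck_on_bilinear[OF _ bounded_bilinear_scaleR] by blast

lemma smooth_on_compose:
  fixes f :: "'b::euclidean_space \<Rightarrow> 'c::real_normed_vector"
  shows "open S \<Longrightarrow> g ` S \<subseteq> T \<Longrightarrow> smooth_on T f \<Longrightarrow> smooth_on S g \<Longrightarrow> smooth_on S (\<lambda>x. f (g x))"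
  unfolding smooth_on_def using Ck_on_compose by blast

lemma smooth_on_powr:
  fixes f :: "'a::real_normed_vector \<Rightarrow> real"
  assumes "open S" "smooth_on S f" "\<And>x. x \<in> S \<Longrightarrow> f x > 0"
  shows "smooth_on S (\<lambda>x. f x powr s)"
proof (rule smooth_on_compose[OF assms(1) _ _ assms(2)])
  show "smooth_on {0<..} (\<lambda>x::real. x powr s)"
    by (simp add: smooth_on_def Ck_on_powr)
qed (use assms(3) in auto)

lemma smooth_on_differentiable: "smooth_on S f \<Longrightarrow> x \<in> S \<Longrightarrow> f differentiable (at x)"
  unfolding smooth_on_def using Ck_on.simps(2) by blast

lemma smooth_on_continuous: "smooth_on S f \<Longrightarrow> continuous_on S f"
  unfolding smooth_on_def using Ck_on.simps(1) by blast

lemma smooth_on_frechet: "smooth_on S f \<Longrightarrow> smooth_on S (\<lambda>x. frechet_derivative f (at x) v)"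
  unfolding smooth_on_def using Ck_on.simps(2) by blast

text \<open>A function is smooth as soon as its derivative is. This is how potentials of smooth forms are
  recognized as smooth.\<close>

lemma smooth_on_has_derivative:
  assumes "open S" "\<And>x. x \<in> S \<Longrightarrow> (f has_derivative f' x) (at x)"
    and "\<And>v. smooth_on S (\<lambda>x. f' x v)"
  shows "smooth_on S f"
proof -
  have "Ck_on k S f" for k
    using assms(3) by (intro Ck_on_SucD[OF Ck_on_Suc_has_derivative[OF assms(1,2)]]) (auto simp: smooth_on_def)
  then show ?thesis
    by (simp add: smooth_on_def)
qed

lemma smooth_on_vec_iff:
  fixes f :: "'a::real_normed_vector \<Rightarrow> 'b::euclidean_space ^ 'n::finite"
  assumes "open S"
  shows "smooth_on S f \<longleftrightarrow> (\<forall>i. smooth_on S (\<lambda>x. f x $ i))"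
proof
  assume R: "\<forall>i. smooth_on S (\<lambda>x. f x $ i)"
  have "bounded_linear (axis i :: 'b \<Rightarrow> 'b ^ 'n)" for i
    unfolding linear_conv_bounded_linear[symmetric] by (rule linearI) (auto simp: vec_eq_iff axis_def)
  then have "smooth_on S (\<lambda>x. axis i (f x $ i))" for i
    using smooth_on_linear[OF \<open>open S\<close>, of "axis i" "\<lambda>x. f x $ i"] R by blast
  then have "smooth_on S (\<lambda>x. \<Sum>i\<in>UNIV. axis i (f x $ i))"
    unfolding smooth_on_def by (auto intro!: Ck_on_sum \<open>open S\<close>)
  moreover have "(\<Sum>i\<in>UNIV. axis i (f x $ i)) = f x" for x
    by (simp add: vec_eq_iff axis_def)
  ultimately show "smooth_on S f"
    by simp
qed (auto intro!: smooth_on_linear[OF \<open>open S\<close> bounded_linear_vec_nth])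

section \<open>Partial derivatives in the plane\<close>

definition partial :: "2 \<Rightarrow> (real^2 \<Rightarrow> real) \<Rightarrow> real^2 \<Rightarrow> real" where
  "partial i f z = frechet_derivative f (at z) (axis i 1)"

lemma has_derivative_partial:
  assumes "f differentiable (at z)"
  shows "(f has_derivative (\<lambda>v. partial 1 f z * v $ 1 + partial 2 f z * v $ 2)) (at z)"
proof -
  have f: "(f has_derivative frechet_derivative f (at z)) (at z)"
    using assms frechet_derivative_works by blast
  interpret linear "frechet_derivative f (at z)"
    using f has_derivative_linear by blast
  have "frechet_derivative f (at z) v = partial 1 f z * v $ 1 + partial 2 f z * v $ 2" for v
  proof -
    have "v = v $ 1 *\<^sub>R axis 1 1 + v $ 2 *\<^sub>R axis 2 1"
      by (simp add: vec_eq_iff axis_def forall_2)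
    then have "frechet_derivative f (at z) v =
        frechet_derivative f (at z) (v $ 1 *\<^sub>R axis 1 1 + v $ 2 *\<^sub>R axis 2 1)"
      by simp
    then show ?thesis
      by (simp add: add scaleR partial_def)
  qed
  then show ?thesis
    by (intro has_derivative_eq_rhs[OF f] ext)
qed

lemma partialI: "(f has_derivative f') (at z) \<Longrightarrow> partial i f z = f' (axis i 1)"
  by (simp add: partial_def frechet_derivative_at[symmetric])

lemma partial_cong:
  assumes "open W" "z \<in> W" "\<And>x. x \<in> W \<Longrightarrow> f x = h x" "f differentiable (at z)"
  shows "partial i h z = partial i f z"
  using frechet_derivative_transform_within_open[OF assms(4,1,2,3)] by (simp add: partial_def)

lemma partial_const: "partial i (\<lambda>x. c) z = 0"
  by (simp add: partial_def)

lemma partial_add: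
  assumes "f differentiable (at z)" "h differentiable (at z)"
  shows "partial i (\<lambda>x. f x + h x) z = partial i f z + partial i h z"
  by (subst partialI[OF has_derivative_add[OF assms[unfolded frechet_derivative_works]]])
    (simp add: partial_def)

lemma partial_diff:
  assumes "f differentiable (at z)" "h differentiable (at z)"
  shows "partial i (\<lambda>x. f x - h x) z = partial i f z - partial i h z"
  by (subst partialI[OF has_derivative_diff[OF assms[unfolded frechet_derivative_works]]])
    (simp add: partial_def)

lemma partial_minus:
  assumes "f differentiable (at z)"
  shows "partial i (\<lambda>x. - f x) z = - partial i f z"
  by (subst partialI[OF has_derivative_minus[OF assms[unfolded frechet_derivative_works]]])
    (simp add: partial_def)

lemma partial_mult:
  assumes "f differentiable (at z)" "h differentiable (at z)"
  shows "partial i (\<lambda>x. f x * h x) z = f z * partial i h z + partial i f z * h z"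
  by (subst partialI[OF has_derivative_mult[OF assms[unfolded frechet_derivative_works]]])
    (simp add: partial_def)

lemma has_derivative_powr_const:
  fixes f :: "'a::real_normed_vector \<Rightarrow> real"
  assumes "f differentiable (at z)" "f z > 0"
  shows "((\<lambda>x. f x powr s) has_derivative (\<lambda>h. s * f z powr (s - 1) * frechet_derivative f (at z) h)) (at z)"
proof -
  have "((\<lambda>x. f x powr s) has_derivative
      (\<lambda>h. f z powr s * (0 * ln (f z) + frechet_derivative f (at z) h * s / f z))) (at z)"
    using assms by (intro has_derivative_powr) (auto simp: frechet_derivative_works)
  then show ?thesis
    by (rule has_derivative_eq_rhs) (use assms(2) in \<open>simp add: fun_eq_iff powr_diff\<close>)
qed

lemma differentiable_powr_const:
  fixes f :: "'a::real_normed_vector \<Rightarrow> real"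
  shows "f differentiable (at z) \<Longrightarrow> f z > 0 \<Longrightarrow> (\<lambda>x. f x powr s) differentiable (at z)"
  unfolding differentiable_def[of "\<lambda>x. f x powr s"] by (intro exI) (rule has_derivative_powr_const)

lemma partial_powr:
  assumes "f differentiable (at z)" "f z > 0"
  shows "partial i (\<lambda>x. f x powr s) z = s * f z powr (s - 1) * partial i f z"
  unfolding partialI[OF has_derivative_powr_const[OF assms]] by (simp add: partial_def)

lemma smooth_on_partial: "smooth_on S f \<Longrightarrow> smooth_on S (partial i f)"
  using smooth_on_frechet[of S f "axis i 1"] unfolding partial_def[abs_def] .

section \<open>Hamiltonian and geodesic equation of a metric\<close>

text \<open>The quadratic form \<open>(\<partial>\<^sub>l g)(v, v)\<close>; at the velocity \<open>v\<close> dual to a covector it is \<open>-2 \<partial>H/\<partial>z\<^sub>l\<close>.\<close>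

definition dmetric :: "(real^2 \<Rightarrow> real^2^2) \<Rightarrow> 2 \<Rightarrow> real^2 \<Rightarrow> real^2 \<Rightarrow> real" where
  "dmetric g l z v = (\<Sum>i\<in>UNIV. \<Sum>j\<in>UNIV. partial l (\<lambda>u. g u $ i $ j) z * v $ i * v $ j)"

text \<open>The Poisson bracket \<open>{A p\<^sub>1 + B p\<^sub>2, H}\<close>, expressed through the velocity \<open>v\<close> instead of the covector
  \<open>p = g v\<close>. In terms of \<open>v\<close> no derivative of the inverse metric occurs.\<close>

definition lin_bracket ::
  "(real^2 \<Rightarrow> real^2^2) \<Rightarrow> (real^2 \<Rightarrow> real) \<Rightarrow> (real^2 \<Rightarrow> real) \<Rightarrow> real^2 \<Rightarrow> real^2 \<Rightarrow> real" where
  "lin_bracket g A B z v =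
     (\<Sum>i\<in>UNIV. (partial i A z * (g z *v v) $ 1 + partial i B z * (g z *v v) $ 2) * v $ i)
     + (A z * dmetric g 1 z v + B z * dmetric g 2 z v) / 2"

lemma mv2: "((M :: real^2^2) *v v) $ i = M $ i $ 1 * v $ 1 + M $ i $ 2 * v $ 2"
  by (simp add: matrix_vector_mult_def sum_2)

locale metric_domain =
  fixes W :: "(real^2) set" and g :: "real^2 \<Rightarrow> real^2^2"
  assumes open_W: "open W" and metric: "riemannian_metric_on W g"
begin

abbreviation sharp :: "real^2 \<Rightarrow> real^2 \<Rightarrow> real^2" where
  "sharp z p \<equiv> matrix_inv (g z) *v p"

definition gdet :: "real^2 \<Rightarrow> real" where
  "gdet z = g z $ 1 $ 1 * g z $ 2 $ 2 - g z $ 1 $ 2 * g z $ 1 $ 2"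

lemma metric_sym:
  assumes "z \<in> W"
  shows "g z $ 2 $ 1 = g z $ 1 $ 2"
proof -
  have "transpose (g z) $ 1 $ 2 = g z $ 1 $ 2"
    using assms metric unfolding riemannian_metric_on_def by simp
  then show ?thesis
    by (simp add: transpose_def)
qed

lemma metric_pos:
  assumes "z \<in> W" "v \<noteq> 0"
  shows "v \<bullet> (g z *v v) > 0"
  using assms metric unfolding riemannian_metric_on_def by blast

lemma gdet_pos:
  assumes "z \<in> W"
  shows "gdet z > 0"
proof -
  have "(axis 1 1 :: real^2) \<noteq> 0"
    by (simp add: axis_eq_0_iff)
  from metric_pos[OF assms this] have g11: "g z $ 1 $ 1 > 0"
    by (simp add: inner_vec_def sum_2 mv2 axis_def)
  let ?v = "vector [- g z $ 1 $ 2, g z $ 1 $ 1] :: real^2"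
  have "?v \<noteq> 0"
    using g11 by (simp add: vec_eq_iff forall_2)
  from metric_pos[OF assms this] have "g z $ 1 $ 1 * gdet z > 0"
    by (simp add: inner_vec_def sum_2 mv2 gdet_def metric_sym[OF assms] algebra_simps)
  then show ?thesis
    using g11 by (simp add: zero_less_mult_iff)
qed

lemma det_metric: "z \<in> W \<Longrightarrow> det (g z) = gdet z"
  by (simp add: det_2 gdet_def metric_sym)

lemma metric_inverse:
  assumes "z \<in> W"
  shows "g z ** matrix_inv (g z) = mat 1 \<and> matrix_inv (g z) ** g z = mat 1"
proof -
  have "invertible (g z)"
    using gdet_pos[OF assms] by (simp add: invertible_det_nz det_metric[OF assms])
  then show ?thesis
    unfolding invertible_def matrix_inv_def by (rule someI_ex)
qed

lemma flat_sharp: "z \<in> W \<Longrightarrow> g z *v sharp z p = p"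
  by (metis matrix_vector_mul_assoc metric_inverse matrix_vector_mul_lid)

lemma sharp_flat: "z \<in> W \<Longrightarrow> sharp z (g z *v v) = v"
  by (metis matrix_vector_mul_assoc metric_inverse matrix_vector_mul_lid)

lemma sharp_eq:
  assumes "z \<in> W"
  shows "sharp z p = vector [(g z $ 2 $ 2 * p $ 1 - g z $ 1 $ 2 * p $ 2) / gdet z,
                             (g z $ 1 $ 1 * p $ 2 - g z $ 1 $ 2 * p $ 1) / gdet z]" (is "_ = ?v")
proof -
  have D: "gdet z \<noteq> 0"
    using gdet_pos[OF assms] by simp
  have "gdet z * (g z *v ?v) $ 1 = gdet z * p $ 1" "gdet z * (g z *v ?v) $ 2 = gdet z * p $ 2"
    using D by (simp_all add: mv2 metric_sym[OF assms] distrib_left)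
      (simp_all add: gdet_def algebra_simps)
  then have "g z *v ?v = p"
    using D by (simp add: vec_eq_iff forall_2)
  then show ?thesis
    using sharp_flat[OF assms, of ?v] by simp
qed

lemma smooth_metric: "smooth_on W (\<lambda>z. g z $ i $ j)"
  using metric open_W unfolding riemannian_metric_on_def by (simp add: smooth_on_vec_iff)

lemma diff_metric: "z \<in> W \<Longrightarrow> (\<lambda>z. g z $ i $ j) differentiable (at z)"
  using smooth_on_differentiable[OF smooth_metric] .

lemma partial_metric_sym: "z \<in> W \<Longrightarrow> partial l (\<lambda>u. g u $ 2 $ 1) z = partial l (\<lambda>u. g u $ 1 $ 2) z"
  by (rule partial_cong[OF open_W]) (auto simp: metric_sym diff_metric)

lemma dmetric_eq: "z \<in> W \<Longrightarrow> dmetric g l z v = partial l (\<lambda>u. g u $ 1 $ 1) z * (v $ 1)\<^sup>2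
   + 2 * partial l (\<lambda>u. g u $ 1 $ 2) z * v $ 1 * v $ 2 + partial l (\<lambda>u. g u $ 2 $ 2) z * (v $ 2)\<^sup>2"
  by (simp add: dmetric_def sum_2 partial_metric_sym power2_eq_square)

lemma hamiltonian_eq:
  assumes "z \<in> W"
  shows "geodesic_hamiltonian g (z, p) =
    (g z $ 2 $ 2 * (p $ 1)\<^sup>2 - 2 * g z $ 1 $ 2 * p $ 1 * p $ 2 + g z $ 1 $ 1 * (p $ 2)\<^sup>2) / (2 * gdet z)"
  using gdet_pos[OF assms]
  by (simp add: geodesic_hamiltonian_def sharp_eq[OF assms] inner_vec_def sum_2 field_simps power2_eq_square)

text \<open>The inverse matrix is differentiated as a quotient of polynomials in the entries of \<open>g\<close>. Substituting
  \<open>p = g v\<close> makes the denominators cancel and turns the result into a polynomial in \<open>v\<close>.\<close>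

lemma has_derivative_hamiltonian:
  fixes p :: "real^2"
  assumes z: "z \<in> W"
  defines "v \<equiv> sharp z p"
  shows "(geodesic_hamiltonian g has_derivative
     (\<lambda>(h, k). k \<bullet> v - (dmetric g 1 z v * h $ 1 + dmetric g 2 z v * h $ 2) / 2)) (at (z, p))"
proof -
  define num where "num = (\<lambda>w :: (real^2) \<times> (real^2). g (fst w) $ 2 $ 2 * (snd w $ 1 * snd w $ 1)
    - 2 * (g (fst w) $ 1 $ 2 * (snd w $ 1 * snd w $ 2)) + g (fst w) $ 1 $ 1 * (snd w $ 2 * snd w $ 2))"
  define den where "den = (\<lambda>w :: (real^2) \<times> (real^2).
    g (fst w) $ 1 $ 1 * g (fst w) $ 2 $ 2 - g (fst w) $ 1 $ 2 * g (fst w) $ 1 $ 2)"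
  define dg where "dg = (\<lambda>i j (h::real^2). partial 1 (\<lambda>u. g u $ i $ j) z * h $ 1 + partial 2 (\<lambda>u. g u $ i $ j) z * h $ 2)"
  have dgI: "((\<lambda>w. g (fst w) $ i $ j) has_derivative (\<lambda>w. dg i j (fst w))) (at (z, p))" for i j
    using has_derivative_compose[OF has_derivative_fst[OF has_derivative_ident], of _ _ "(z, p)" UNIV]
        has_derivative_partial[OF diff_metric[OF z, of i j]]
    unfolding dg_def by fastforce
  have dp: "((\<lambda>w::(real^2)\<times>(real^2). snd w $ i) has_derivative (\<lambda>w. snd w $ i)) (at (z, p))" for i
    by (intro bounded_linear_imp_has_derivative bounded_linear_compose[OF bounded_linear_vec_nth] bounded_linear_snd)
  have D: "den (z, p) \<noteq> 0"
    using gdet_pos[OF z] by (simp add: gdet_def den_def)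
  define dnum where "dnum = (\<lambda>(h, k :: real^2). dg 2 2 h * (p $ 1 * p $ 1) + 2 * g z $ 2 $ 2 * p $ 1 * k $ 1
     - 2 * (dg 1 2 h * (p $ 1 * p $ 2) + g z $ 1 $ 2 * (p $ 1 * k $ 2 + p $ 2 * k $ 1))
     + dg 1 1 h * (p $ 2 * p $ 2) + 2 * g z $ 1 $ 1 * p $ 2 * k $ 2)"
  define dden where "dden = (\<lambda>(h, k :: real^2). dg 1 1 h * g z $ 2 $ 2 + g z $ 1 $ 1 * dg 2 2 h - 2 * g z $ 1 $ 2 * dg 1 2 h)"
  have num: "(num has_derivative dnum) (at (z, p))"
    unfolding num_def
    by (rule has_derivative_eq_rhs[OF has_derivative_add[OF has_derivative_diff[OF
          has_derivative_mult[OF dgI has_derivative_mult[OF dp dp]]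
          has_derivative_mult[OF has_derivative_const has_derivative_mult[OF dgI has_derivative_mult[OF dp dp]]]]
          has_derivative_mult[OF dgI has_derivative_mult[OF dp dp]]]])
      (simp add: dnum_def fun_eq_iff algebra_simps)
  have den: "(den has_derivative dden) (at (z, p))"
    unfolding den_def
    by (rule has_derivative_eq_rhs[OF has_derivative_diff[OF has_derivative_mult[OF dgI dgI]
          has_derivative_mult[OF dgI dgI]]])
      (simp add: dden_def fun_eq_iff algebra_simps)
  have p: "p $ 1 = g z $ 1 $ 1 * v $ 1 + g z $ 1 $ 2 * v $ 2" "p $ 2 = g z $ 1 $ 2 * v $ 1 + g z $ 2 $ 2 * v $ 2"
    using flat_sharp[OF z, of p] unfolding v_def[symmetric] by (metis mv2 metric_sym[OF z])+
  have num_eq: "num (z, p) = den (z, p) * (v \<bullet> p)"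
    by (simp add: num_def den_def inner_vec_def sum_2 p algebra_simps)
  have numer: "dnum w - (v \<bullet> p) * dden w = den (z, p) *
      (2 * (snd w \<bullet> v) - (dmetric g 1 z v * fst w $ 1 + dmetric g 2 z v * fst w $ 2))" for w
    by (cases w) (simp add: dnum_def dden_def den_def inner_vec_def sum_2 p dmetric_eq[OF z] dg_def
        power2_eq_square algebra_simps)
  have quot: "(dnum w * den (z, p) - num (z, p) * dden w) / (den (z, p) * den (z, p)) =
      2 * (snd w \<bullet> v) - (dmetric g 1 z v * fst w $ 1 + dmetric g 2 z v * fst w $ 2)" for w
  proof -
    have "dnum w * den (z, p) - num (z, p) * dden w = den (z, p) * (dnum w - (v \<bullet> p) * dden w)"
      by (simp add: num_eq algebra_simps)
    then show ?thesis
      unfolding numer using D by simp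
  qed
  from has_derivative_divide'[OF num den D, unfolded quot]
  have "((\<lambda>w. num w / den w * (1 / 2)) has_derivative (\<lambda>w. (2 * (snd w \<bullet> v)
      - (dmetric g 1 z v * fst w $ 1 + dmetric g 2 z v * fst w $ 2)) * (1 / 2))) (at (z, p))"
    by (rule has_derivative_mult_left)
  then have "((\<lambda>w. num w / den w * (1 / 2)) has_derivative
      (\<lambda>(h, k). k \<bullet> v - (dmetric g 1 z v * h $ 1 + dmetric g 2 z v * h $ 2) / 2)) (at (z, p))"
    by (rule has_derivative_eq_rhs) (auto simp: fun_eq_iff field_simps)
  moreover have "num w / den w * (1 / 2) = geodesic_hamiltonian g w" if "w \<in> W \<times> UNIV" for w
    using that by (cases w) (simp add: hamiltonian_eq num_def den_def gdet_def power2_eq_square mult_ac)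
  ultimately show ?thesis
    using has_derivative_transform_within_open[of _ _ "(z, p)" UNIV "W \<times> UNIV"] open_W z
    by (fastforce simp: open_Times)
qed

text \<open>The quotient rule reduces the integral condition to the cubic form in the numerator.\<close>

lemma poisson_fractional_linear:
  fixes p :: "real^2"
  assumes z: "z \<in> W" and diff: "A differentiable (at z)" "B differentiable (at z)"
      "C differentiable (at z)" "E differentiable (at z)"
    and M: "C z * p $ 1 + E z * p $ 2 \<noteq> 0"
  defines "v \<equiv> sharp z p"
  shows "poisson (fractional_linear A B C E) (geodesic_hamiltonian g) (z, p) =
    (lin_bracket g A B z v * (C z * p $ 1 + E z * p $ 2)
      - (A z * p $ 1 + B z * p $ 2) * lin_bracket g C E z v) / (C z * p $ 1 + E z * p $ 2)\<^sup>2"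
proof -
  have fI: "((\<lambda>w. f (fst w)) has_derivative
      (\<lambda>w. partial 1 f z * fst w $ 1 + partial 2 f z * fst w $ 2)) (at (z, p))"
    if "f differentiable (at z)" for f
    using has_derivative_compose[OF has_derivative_fst[OF has_derivative_ident], of _ _ "(z, p)" UNIV]
        has_derivative_partial[OF that] by fastforce
  have dp: "((\<lambda>w::(real^2)\<times>(real^2). snd w $ i) has_derivative (\<lambda>w. snd w $ i)) (at (z, p))" for i
    by (intro bounded_linear_imp_has_derivative bounded_linear_compose[OF bounded_linear_vec_nth] bounded_linear_snd)
  define L where "L = (\<lambda>A B (w :: (real^2) \<times> (real^2)). A (fst w) * snd w $ 1 + B (fst w) * snd w $ 2 :: real)"
  define L' where "L' = (\<lambda>A B (w :: (real^2) \<times> (real^2)).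
     (partial 1 A z * fst w $ 1 + partial 2 A z * fst w $ 2) * p $ 1 + A z * snd w $ 1
     + ((partial 1 B z * fst w $ 1 + partial 2 B z * fst w $ 2) * p $ 2 + B z * snd w $ 2))"
  have L: "(L A B has_derivative L' A B) (at (z, p))"
    if "A differentiable (at z)" "B differentiable (at z)" for A B
    unfolding L_def
    by (rule has_derivative_eq_rhs[OF has_derivative_add[OF has_derivative_mult[OF fI[OF that(1)] dp]
          has_derivative_mult[OF fI[OF that(2)] dp]]])
      (simp add: L'_def fun_eq_iff algebra_simps)
  have "fractional_linear A B C E = (\<lambda>w. L A B w / L C E w)"
    by (auto simp: fractional_linear_def L_def fun_eq_iff)
  then have F: "(fractional_linear A B C E has_derivative
      (\<lambda>w. (L' A B w * L C E (z, p) - L A B (z, p) * L' C E w) / (L C E (z, p) * L C E (z, p)))) (at (z, p))"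
    using has_derivative_divide'[OF L[OF diff(1,2)] L[OF diff(3,4)]] M by (simp add: L_def)
  have flat: "g z *v v = p"
    unfolding v_def by (rule flat_sharp[OF z])
  have ax: "axis i 1 \<bullet> v = v $ i" "(axis i 1 :: real^2) $ j = (if j = i then 1 else 0)" for i j
    by (simp_all add: inner_axis') (simp add: axis_def)
  show ?thesis
    unfolding poisson_def frechet_derivative_at[OF F, symmetric]
      frechet_derivative_at[OF has_derivative_hamiltonian[OF z, of p], symmetric]
    using M
    by (simp add: sum_2 L_def L'_def lin_bracket_def flat v_def[symmetric] ax
        divide_simps power2_eq_square) (simp add: algebra_simps)
qed

text \<open>Lowering the index of the acceleration turns the Christoffel symbols into derivatives of the metric.
  The right-hand version is Hamilton's equation for the momentum.\<close>

lemma geodesic_equation_lowered: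
  assumes z: "z \<in> W"
  shows "(\<forall>k. a $ k + (\<Sum>i\<in>UNIV. \<Sum>j\<in>UNIV. christoffel g z k i j * v $ i * v $ j) = 0) \<longleftrightarrow>
    (\<forall>l. (g z *v a) $ l + (\<Sum>i\<in>UNIV. \<Sum>j\<in>UNIV. partial i (\<lambda>u. g u $ j $ l) z * v $ i * v $ j)
        = dmetric g l z v / 2)"
proof -
  define c :: "real^2" where "c = (\<chi> l. (\<Sum>i\<in>UNIV. \<Sum>j\<in>UNIV. partial i (\<lambda>u. g u $ j $ l) z * v $ i * v $ j)
     - dmetric g l z v / 2)"
  have "(\<Sum>i\<in>UNIV. \<Sum>j\<in>UNIV. christoffel g z k i j * v $ i * v $ j) = sharp z c $ k" for k
    by (simp add: christoffel_def mv2 c_def sum_2 dmetric_def partial_def[symmetric]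
        add_divide_distrib diff_divide_distrib) (simp add: field_simps)
  then have "(\<forall>k. a $ k + (\<Sum>i\<in>UNIV. \<Sum>j\<in>UNIV. christoffel g z k i j * v $ i * v $ j) = 0) \<longleftrightarrow> a + sharp z c = 0"
    by (simp add: vec_eq_iff)
  also have "\<dots> \<longleftrightarrow> g z *v a + c = 0"
    using flat_sharp[OF z, of c] sharp_flat[OF z, of a]
    by (metis matrix_vector_right_distrib mult_zero_right matrix_vector_mult_0_right)
  finally show ?thesis
    by (simp add: vec_eq_iff c_def algebra_simps)
qed

end

lemma smooth_curve:
  assumes "open T" "smooth_on T \<gamma>"
  shows "t \<in> T \<Longrightarrow> (\<gamma> has_vector_derivative velocity \<gamma> t) (at t)" and "smooth_on T (velocity \<gamma>)"
proof -
  have d: "(\<gamma> has_vector_derivative velocity \<gamma> t) (at t)" if "t \<in> T" for t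
    unfolding velocity_def using smooth_on_differentiable[OF assms(2) that]
    by (simp add: vector_derivative_works differentiable_def)
  then show "t \<in> T \<Longrightarrow> (\<gamma> has_vector_derivative velocity \<gamma> t) (at t)" .
  have "frechet_derivative \<gamma> (at t) 1 = velocity \<gamma> t" if "t \<in> T" for t
    using frechet_derivative_at[OF d[OF that, unfolded has_vector_derivative_def]] by (metis scaleR_one)
  then show "smooth_on T (velocity \<gamma>)"
    by (rule smooth_on_cong[OF assms(1) _ smooth_on_frechet[OF assms(2)]])
qed

lemma has_derivative_along_curve:
  assumes "(\<gamma> has_vector_derivative v) (at t)" "f differentiable (at (\<gamma> t))"
  shows "((\<lambda>s. f (\<gamma> s)) has_real_derivative partial 1 f (\<gamma> t) * v $ 1 + partial 2 f (\<gamma> t) * v $ 2) (at t)"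
  using has_derivative_compose[OF assms(1)[unfolded has_vector_derivative_def] has_derivative_partial[OF assms(2)]]
  unfolding has_field_derivative_def by (rule has_derivative_eq_rhs) (simp add: fun_eq_iff algebra_simps)

context metric_domain
begin

text \<open>A geodesic together with its momentum \<open>g \<gamma>'\<close> is a solution of Hamilton's equations, so the
  derivative of a function along it is the Poisson bracket with \<open>H\<close>.\<close>

lemma bracket_along_geodesic:
  assumes "open T" "t \<in> T" and geo: "geodesic_on T g \<gamma>" and z: "\<gamma> t \<in> W"
    and diff: "A differentiable (at (\<gamma> t))" "B differentiable (at (\<gamma> t))"
  shows "((\<lambda>s. A (\<gamma> s) * (g (\<gamma> s) *v velocity \<gamma> s) $ 1 + B (\<gamma> s) * (g (\<gamma> s) *v velocity \<gamma> s) $ 2)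
     has_real_derivative lin_bracket g A B (\<gamma> t) (velocity \<gamma> t)) (at t)"
proof -
  define z where "z = \<gamma> t"
  define v where "v = velocity \<gamma> t"
  define a where "a = velocity (velocity \<gamma>) t"
  have "smooth_on T \<gamma>"
    using geo by (simp add: geodesic_on_def)
  note c = smooth_curve[OF \<open>open T\<close> this]
  have d1: "(\<gamma> has_vector_derivative v) (at t)"
    unfolding v_def by (rule c(1)[OF \<open>t \<in> T\<close>])
  have d2: "(velocity \<gamma> has_vector_derivative a) (at t)"
    unfolding a_def by (rule smooth_curve(1)[OF \<open>open T\<close> c(2) \<open>t \<in> T\<close>])
  have zW: "z \<in> W"
    using z by (simp add: z_def)
  have dv: "((\<lambda>s. velocity \<gamma> s $ j) has_real_derivative a $ j) (at t)" for j
    using bounded_linear.has_vector_derivative[OF bounded_linear_vec_nth d2]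
    by (simp add: has_real_derivative_iff_has_vector_derivative)
  note chain = has_derivative_along_curve[OF d1]
  have geq: "(g z *v a) $ l + (\<Sum>i\<in>UNIV. \<Sum>j\<in>UNIV. partial i (\<lambda>u. g u $ j $ l) z * v $ i * v $ j)
        = dmetric g l z v / 2" for l
    using geo \<open>t \<in> T\<close> geodesic_equation_lowered[OF zW, of a v]
    by (simp add: geodesic_on_def z_def v_def a_def)
  have "((\<lambda>s. g (\<gamma> s) $ l $ 1 * velocity \<gamma> s $ 1 + g (\<gamma> s) $ l $ 2 * velocity \<gamma> s $ 2)
     has_real_derivative dmetric g l z v / 2) (at t)" for l
    unfolding geq[of l, symmetric]
    by (rule DERIV_cong[OF DERIV_add[OF DERIV_mult[OF chain[OF diff_metric[OF z]] dv]
          DERIV_mult[OF chain[OF diff_metric[OF z]] dv]]])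
      (use exhaust_2[of l] in \<open>auto simp: mv2 sum_2 z_def[symmetric] v_def[symmetric] partial_metric_sym[OF zW]
        algebra_simps\<close>)
  then have P: "((\<lambda>s. (g (\<gamma> s) *v velocity \<gamma> s) $ l) has_real_derivative dmetric g l z v / 2) (at t)" for l
    by (simp add: mv2)
  show ?thesis
    by (rule DERIV_cong[OF DERIV_add[OF DERIV_mult[OF chain[OF diff(1)] P] DERIV_mult[OF chain[OF diff(2)] P]]])
      (simp add: lin_bracket_def z_def[symmetric] v_def[symmetric] sum_2 algebra_simps add_divide_distrib)
qed

end

section \<open>First integrals of webs\<close>

text \<open>Constancy of \<open>f\<close> on the leaves is expressed by derivatives along curves, which is the form in which it
  is used.\<close>

definition first_integral :: "(real^2) set \<Rightarrow> (real^2) set set \<Rightarrow> (real^2 \<Rightarrow> real) \<Rightarrow> bool" where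
  "first_integral V \<F> f \<longleftrightarrow> smooth_on V f \<and> (\<forall>z\<in>V. partial 1 f z \<noteq> 0 \<or> partial 2 f z \<noteq> 0) \<and>
     (\<forall>L\<in>\<F>. \<forall>T \<gamma>. open T \<longrightarrow> smooth_on T \<gamma> \<longrightarrow> \<gamma> ` T \<subseteq> L \<longrightarrow> (\<forall>t\<in>T. \<gamma> t \<in> V \<longrightarrow>
       partial 1 f (\<gamma> t) * velocity \<gamma> t $ 1 + partial 2 f (\<gamma> t) * velocity \<gamma> t $ 2 = 0))"

text \<open>The second component of a foliated chart does it. A curve in a leaf stays, for short times, in one
  path component of the intersection of the leaf with the chart, that is, in one plaque.\<close>

lemma foliation_first_integral:
  assumes fol: "foliation W \<F>" and "z\<^sub>0 \<in> W"
  obtains V f where "open V" "z\<^sub>0 \<in> V" "V \<subseteq> W" "first_integral V \<F> f"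
proof -
  have "\<exists>V (\<phi> :: real^2 \<Rightarrow> real^2) a b.
      z\<^sub>0 \<in> V \<and> V \<subseteq> W \<and> diffeo_on V \<phi> \<and> \<phi> ` V = box a b \<and>
      (\<forall>L\<in>\<F>. \<forall>x\<in>L \<inter> V. path_component_set (L \<inter> V) x = {y\<in>V. \<phi> y $ 2 = \<phi> x $ 2})"
    using fol \<open>z\<^sub>0 \<in> W\<close> unfolding foliation_def by simp
  then obtain V and \<phi> :: "real^2 \<Rightarrow> real^2" and a b where V: "z\<^sub>0 \<in> V" "V \<subseteq> W" "diffeo_on V \<phi>" "\<phi> ` V = box a b"
    and "\<forall>L\<in>\<F>. \<forall>x\<in>L \<inter> V. path_component_set (L \<inter> V) x = {y\<in>V. \<phi> y $ 2 = \<phi> x $ 2}"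
    by (elim exE conjE) (rule that)
  then have plaque: "path_component_set (L \<inter> V) x = {y\<in>V. \<phi> y $ 2 = \<phi> x $ 2}"
    if "L \<in> \<F>" "x \<in> L \<inter> V" for L x
    using that by simp
  define f where "f = (\<lambda>y. \<phi> y $ 2)"
  have "open V" and inj: "inj_on \<phi> V" and sm: "smooth_on V \<phi>" and
    "open (\<phi> ` V)" and si: "smooth_on (\<phi> ` V) (inv_into V \<phi>)"
    using V(3) by (auto simp: diffeo_on_def)
  have smf: "smooth_on V f"
    unfolding f_def by (rule smooth_on_linear[OF \<open>open V\<close> bounded_linear_vec_nth sm])
  have nz: "partial 1 f z \<noteq> 0 \<or> partial 2 f z \<noteq> 0" if z: "z \<in> V" for z
  proof (rule ccontr)
    assume *: "\<not> ?thesis"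
    have df: "(f has_derivative (\<lambda>v. 0)) (at z)"
      using has_derivative_partial[OF smooth_on_differentiable[OF smf z]] * by simp
    obtain \<psi>' where \<psi>': "(inv_into V \<phi> has_derivative \<psi>') (at (\<phi> z))"
      using smooth_on_differentiable[OF si, of "\<phi> z"] z unfolding differentiable_def by blast
    have "inv_into V \<phi> (\<phi> z) = z"
      using inj z by simp
    then have "((\<lambda>y. f (inv_into V \<phi> y)) has_derivative (\<lambda>v. 0)) (at (\<phi> z))"
      using has_derivative_compose[OF \<psi>', of f "\<lambda>v. 0"] df by simp
    then have "((\<lambda>y. y $ 2) has_derivative (\<lambda>v. 0)) (at (\<phi> z))"
      by (rule has_derivative_transform_within_open[OF _ \<open>open (\<phi> ` V)\<close>])
        (use z in \<open>auto simp: f_def f_inv_into_f\<close>)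
    moreover have "((\<lambda>y. y $ 2) has_derivative (\<lambda>v. v $ 2)) (at (\<phi> z))"
      by (intro bounded_linear_imp_has_derivative bounded_linear_vec_nth)
    ultimately have "(\<lambda>v::real^2. 0) = (\<lambda>v. v $ 2)"
      by (rule has_derivative_unique)
    from fun_cong[OF this, of "axis 2 1"] show False
      by (simp add: axis_def)
  qed
  have const: "partial 1 f (\<gamma> t) * velocity \<gamma> t $ 1 + partial 2 f (\<gamma> t) * velocity \<gamma> t $ 2 = 0"
    if "L \<in> \<F>" "open T" and \<gamma>: "smooth_on T \<gamma>" "\<gamma> ` T \<subseteq> L" and t: "t \<in> T" "\<gamma> t \<in> V" for L T \<gamma> t
  proof -
    have "continuous_on T \<gamma>"
      using \<gamma>(1) by (rule smooth_on_continuous)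
    then have "open (\<gamma> -` V \<inter> T)"
      using \<open>open T\<close> \<open>open V\<close> by (simp add: continuous_on_open_vimage)
    then obtain d where d: "d > 0" "ball t d \<subseteq> \<gamma> -` V \<inter> T"
      using t open_contains_ball by blast
    have pc: "path_connected (\<gamma> ` ball t d)"
      using continuous_on_subset[OF \<open>continuous_on T \<gamma>\<close>, of "ball t d"] d(2)
      by (intro path_connected_continuous_image convex_imp_path_connected convex_ball) simp
    have loc: "f (\<gamma> t) = f (\<gamma> s)" if "s \<in> ball t d" for s
    proof -
      have "path_component (\<gamma> ` ball t d) (\<gamma> t) (\<gamma> s)"
        using pc that \<open>d > 0\<close> unfolding path_connected_component by simp
      moreover have "\<gamma> ` ball t d \<subseteq> L \<inter> V"
        using d \<gamma>(2) by auto
      ultimately have "path_component (L \<inter> V) (\<gamma> t) (\<gamma> s)"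
        by (rule path_component_of_subset[rotated])
      then have "\<gamma> s \<in> path_component_set (L \<inter> V) (\<gamma> t)"
        by simp
      moreover have "\<gamma> t \<in> L \<inter> V"
        using \<gamma>(2) t by blast
      ultimately have "\<gamma> s \<in> {y\<in>V. \<phi> y $ 2 = \<phi> (\<gamma> t) $ 2}"
        by (simp only: plaque[OF \<open>L \<in> \<F>\<close>])
      then show ?thesis
        by (simp add: f_def)
    qed
    have "((\<lambda>s. f (\<gamma> s)) has_real_derivative 0) (at t)"
      by (rule has_field_derivative_transform_within_open[OF DERIV_const[of "f (\<gamma> t)"] open_ball[of t d]])
        (use \<open>d > 0\<close> loc in \<open>simp_all only: centre_in_ball\<close>)
    moreover have "((\<lambda>s. f (\<gamma> s)) has_real_derivative
        partial 1 f (\<gamma> t) * velocity \<gamma> t $ 1 + partial 2 f (\<gamma> t) * velocity \<gamma> t $ 2) (at t)"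
      by (rule has_derivative_along_curve[OF smooth_curve(1)[OF \<open>open T\<close> \<gamma>(1) t(1)]
            smooth_on_differentiable[OF smf t(2)]])
    ultimately show ?thesis
      using DERIV_unique by blast
  qed
  have "first_integral V \<F> f"
    unfolding first_integral_def by (intro conjI ballI allI impI smf nz const)
  with \<open>open V\<close> V(1,2) show thesis
    by (rule that)
qed

text \<open>Needed because transversality in \<open>four_web\<close> is stated through the intersection of sets of tangent
  vectors: parallel tangent vectors of two foliations yield a common one.\<close>

lemma leaf_tangent_scale:
  assumes "v \<in> leaf_tangent \<F> z"
  shows "c *\<^sub>R v \<in> leaf_tangent \<F> z"
proof -
  obtain L \<gamma> e where L: "L \<in> \<F>" "e > 0" "smooth_on {-e<..<e} \<gamma>" "\<gamma> ` {-e<..<e} \<subseteq> L"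
    "\<gamma> 0 = z" "velocity \<gamma> 0 = v"
    using assms unfolding leaf_tangent_def by blast
  define d where "d = e / (\<bar>c\<bar> + 1)"
  have "d > 0"
    using L by (simp add: d_def)
  have sub: "c * t \<in> {-e<..<e}" if "t \<in> {-d<..<d}" for t
  proof -
    have "\<bar>t\<bar> < d"
      using that by auto
    then have "\<bar>t\<bar> * (\<bar>c\<bar> + 1) < d * (\<bar>c\<bar> + 1)"
      by (rule mult_strict_right_mono) simp
    also have "\<dots> = e"
      by (simp add: d_def)
    finally have "\<bar>t\<bar> * (\<bar>c\<bar> + 1) < e" .
    moreover have "\<bar>c * t\<bar> \<le> \<bar>t\<bar> * (\<bar>c\<bar> + 1)"
      by (simp add: abs_mult algebra_simps)
    ultimately have "\<bar>c * t\<bar> < e"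
      by linarith
    then show ?thesis
      by (simp add: abs_less_iff)
  qed
  have "smooth_on {-d<..<d} (\<lambda>t. c * t)"
    by (rule smooth_on_has_derivative[OF _ bounded_linear_imp_has_derivative[OF bounded_linear_mult_right]])
      (auto intro: smooth_on_const)
  then have "smooth_on {-d<..<d} (\<lambda>t. \<gamma> (c * t))"
    using sub by (intro smooth_on_compose[OF _ _ L(3)] image_subsetI) simp_all
  moreover have "velocity (\<lambda>t. \<gamma> (c * t)) 0 = c *\<^sub>R v"
  proof -
    have "(\<gamma> has_vector_derivative v) (at (c * 0))"
      using smooth_curve(1)[OF _ L(3), of 0] L(2,6) by simp
    moreover have "((\<lambda>t. c * t) has_vector_derivative c) (at 0)"
      by (auto intro!: derivative_eq_intros)
    ultimately have "(\<gamma> \<circ> (\<lambda>t. c * t) has_vector_derivative c *\<^sub>R v) (at 0)"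
      by (intro vector_diff_chain_at) simp_all
    then show ?thesis
      unfolding velocity_def o_def by (rule vector_derivative_at)
  qed
  moreover have "(\<lambda>t. \<gamma> (c * t)) ` {-d<..<d} \<subseteq> L"
    using sub L(4) by (intro image_subsetI subsetD[OF L(4)] imageI)
  ultimately show ?thesis
    unfolding leaf_tangent_def using L(1,5) \<open>d > 0\<close>
    by (intro CollectI bexI[of _ L] exI[of _ "\<lambda>t. \<gamma> (c * t)"] exI[of _ d]) simp_all
qed

lemma wedge_swap: "wedge u v = - wedge v u"
  by (simp add: wedge_def)

lemma wedge_self: "wedge u u = 0"
  by (simp add: wedge_def)

text \<open>In the basis \<open>u, v\<close> a cubic form that vanishes at \<open>u\<close> and \<open>v\<close> is \<open>s t (\<alpha> s + \<beta> t)\<close>, and two further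
  zeros force the linear factor to vanish.\<close>

lemma binary_cubic_zero:
  fixes c\<^sub>0 c\<^sub>1 c\<^sub>2 c\<^sub>3 :: real and u v w x y :: "real^2"
  defines "Q \<equiv> \<lambda>y :: real^2. c\<^sub>0 * y $ 1 ^ 3 + c\<^sub>1 * y $ 1 ^ 2 * y $ 2 + c\<^sub>2 * y $ 1 * y $ 2 ^ 2 + c\<^sub>3 * y $ 2 ^ 3"
  assumes Q: "Q u = 0" "Q v = 0" "Q w = 0" "Q x = 0"
    and ne: "wedge u v \<noteq> 0" "wedge u w \<noteq> 0" "wedge u x \<noteq> 0" "wedge v w \<noteq> 0" "wedge v x \<noteq> 0" "wedge w x \<noteq> 0"
  shows "Q y = 0"
proof -
  define \<alpha> where "\<alpha> = 3 * c\<^sub>0 * u $ 1 ^ 2 * v $ 1 + c\<^sub>1 * (2 * u $ 1 * v $ 1 * u $ 2 + u $ 1 ^ 2 * v $ 2)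
    + c\<^sub>2 * (v $ 1 * u $ 2 ^ 2 + 2 * u $ 1 * u $ 2 * v $ 2) + 3 * c\<^sub>3 * u $ 2 ^ 2 * v $ 2"
  define \<beta> where "\<beta> = 3 * c\<^sub>0 * v $ 1 ^ 2 * u $ 1 + c\<^sub>1 * (2 * v $ 1 * u $ 1 * v $ 2 + v $ 1 ^ 2 * u $ 2)
    + c\<^sub>2 * (u $ 1 * v $ 2 ^ 2 + 2 * v $ 1 * v $ 2 * u $ 2) + 3 * c\<^sub>3 * v $ 2 ^ 2 * u $ 2"
  have lin: "Q (s *\<^sub>R u + t *\<^sub>R v) = s ^ 3 * Q u + s ^ 2 * t * \<alpha> + s * t ^ 2 * \<beta> + t ^ 3 * Q v" for s t
    by (simp add: Q_def \<alpha>_def \<beta>_def algebra_simps power2_eq_square power3_eq_cube)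
  have "wedge u v *\<^sub>R y = wedge y v *\<^sub>R u + wedge u y *\<^sub>R v" for y
    by (simp add: vec_eq_iff forall_2 wedge_def algebra_simps)
  moreover have "Q (d *\<^sub>R y) = d ^ 3 * Q y" for d y
    by (simp add: Q_def algebra_simps power2_eq_square power3_eq_cube)
  ultimately have "wedge u v ^ 3 * Q y = Q (wedge y v *\<^sub>R u + wedge u y *\<^sub>R v)" for y
    by metis
  then have exp: "wedge u v ^ 3 * Q y = wedge y v * wedge u y * (wedge y v * \<alpha> + wedge u y * \<beta>)" for y
    unfolding lin Q(1,2) by (simp add: algebra_simps power2_eq_square)
  have anti: "wedge w v \<noteq> 0" "wedge x v \<noteq> 0"
    using ne wedge_swap[of w v] wedge_swap[of x v] by simp_all
  have w: "wedge w v * \<alpha> + wedge u w * \<beta> = 0" and x: "wedge x v * \<alpha> + wedge u x * \<beta> = 0"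
    using exp[of w] exp[of x] Q ne anti by auto
  have pl: "wedge w v * wedge u x - wedge x v * wedge u w = wedge u v * wedge w x"
    by (simp add: wedge_def algebra_simps)
  have "wedge u x * (wedge w v * \<alpha> + wedge u w * \<beta>) - wedge u w * (wedge x v * \<alpha> + wedge u x * \<beta>)
      = (wedge w v * wedge u x - wedge x v * wedge u w) * \<alpha>"
    "wedge w v * (wedge x v * \<alpha> + wedge u x * \<beta>) - wedge x v * (wedge w v * \<alpha> + wedge u w * \<beta>)
      = (wedge w v * wedge u x - wedge x v * wedge u w) * \<beta>"
    by (simp_all add: algebra_simps)
  then have "\<alpha> = 0" "\<beta> = 0"
    using w x ne by (simp_all add: pl)
  then show ?thesis
    using exp[of y] ne by simp
qed

lemma smooth_on_wedge:
  "open S \<Longrightarrow> smooth_on S u \<Longrightarrow> smooth_on S v \<Longrightarrow> smooth_on S (\<lambda>x. wedge (u x) (v x))"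
  unfolding wedge_def by (intro smooth_on_diff smooth_on_mult smooth_on_linear[OF _ bounded_linear_vec_nth])

context metric_domain
begin

lemma wedge_flat: "z \<in> W \<Longrightarrow> wedge (g z *v u) (g z *v v) = gdet z * wedge u v"
  by (simp add: wedge_def mv2 gdet_def metric_sym algebra_simps)

text \<open>A quadratic form is recovered from its values at two basis vectors and their sum. This exhibits the
  coefficients without naming them.\<close>

lemma lin_bracket_quadratic:
  "lin_bracket g A B z v = lin_bracket g A B z (axis 1 1) * v $ 1 ^ 2
    + (lin_bracket g A B z (axis 1 1 + axis 2 1) - lin_bracket g A B z (axis 1 1) - lin_bracket g A B z (axis 2 1)) * v $ 1 * v $ 2
    + lin_bracket g A B z (axis 2 1) * v $ 2 ^ 2"
  by (simp add: lin_bracket_def dmetric_def sum_2 mv2 axis_def add_divide_distrib power2_eq_square) (simp add: field_simps)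

lemma smooth_flat: "smooth_on W X \<Longrightarrow> smooth_on W (\<lambda>z. g z *v X z)"
  using smooth_metric open_W
  by (simp add: smooth_on_vec_iff mv2 smooth_on_add smooth_on_mult)

end

lemma metric_domain_subset:
  assumes "metric_domain W g" "open V" "V \<subseteq> W"
  shows "metric_domain V g"
  using assms unfolding metric_domain_def riemannian_metric_on_def by (auto intro: smooth_on_subset)

text \<open>The coefficients of \<open>N\<close> and \<open>M\<close> are polynomial in the tangent fields \<open>X\<^sub>i\<close>: with \<open>\<and>\<close> for \<open>wedge\<close>, take
  \<open>N(p) = (X\<^sub>2 \<and> X\<^sub>3) (g X\<^sub>1 \<and> p)\<close> and \<open>M(p) = (X\<^sub>1 \<and> X\<^sub>3) (g X\<^sub>2 \<and> p)\<close>. The factors normalize \<open>N / M\<close> to be \<open>1\<close> on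
  the third foliation. On each foliation some nonzero constant combination of \<open>N\<close> and \<open>M\<close> vanishes, which
  treats the values \<open>0\<close>, \<open>\<infinity>\<close>, \<open>1\<close> and the fourth constant alike.\<close>

lemma (in metric_domain) integral_of_web:
  assumes web: "nakai_web W \<F>" and geo: "geodesic_web g \<F>" and "z\<^sub>0 \<in> W"
  shows "\<exists>V A B C E. open V \<and> z\<^sub>0 \<in> V \<and> V \<subseteq> W \<and> fractional_linear_integral V g A B C E"
proof -
  have fol: "foliation W (\<F> i)" if "i \<in> {1..4}" for i
    using web that by (simp add: nakai_web_def four_web_def)
  have "\<exists>V f. open V \<and> z\<^sub>0 \<in> V \<and> V \<subseteq> W \<and> first_integral V (\<F> i) f" if "i \<in> {1..4}" for i
    using foliation_first_integral[OF fol[OF that] \<open>z\<^sub>0 \<in> W\<close>] by metis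
  then obtain U f where U: "\<And>i. i \<in> {1..4} \<Longrightarrow> open (U i) \<and> z\<^sub>0 \<in> U i \<and> U i \<subseteq> W \<and> first_integral (U i) (\<F> i) (f i)"
    by metis
  have nz: "partial 1 (f i) z \<noteq> 0 \<or> partial 2 (f i) z \<noteq> 0" if "i \<in> {1..4}" "z \<in> U i" for i z
    using U[OF that(1)] that(2) by (simp add: first_integral_def)
  have first: "partial 1 (f i) (\<gamma> t) * velocity \<gamma> t $ 1 + partial 2 (f i) (\<gamma> t) * velocity \<gamma> t $ 2 = 0"
    if i: "i \<in> {1..4}" and "L \<in> \<F> i" "open T" "smooth_on T \<gamma>" "\<gamma> ` T \<subseteq> L" "t \<in> T" "\<gamma> t \<in> U i" for i L T \<gamma> t
    using U[OF i, THEN conjunct2, THEN conjunct2, THEN conjunct2, unfolded first_integral_def,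
        THEN conjunct2, THEN conjunct2, rule_format, OF that(2-7)] .
  define V where "V = (\<Inter>i\<in>{1..4}. U i)"
  have "V \<subseteq> U 1" "U 1 \<subseteq> W"
    unfolding V_def using U[of 1] by (auto intro: INF_lower)
  moreover have "open V" "z\<^sub>0 \<in> V"
    using U by (auto simp: V_def intro!: open_INT)
  ultimately have V: "open V" "z\<^sub>0 \<in> V" "V \<subseteq> W"
    by auto
  have VU: "z \<in> U i" if "z \<in> V" "i \<in> {1..4}" for z i
    using that by (auto simp: V_def)
  interpret V: metric_domain V g
    by (rule metric_domain_subset[OF _ V(1,3)]) (rule metric_domain_axioms)
  define X :: "nat \<Rightarrow> real^2 \<Rightarrow> real^2" where "X = (\<lambda>i z. vector [- partial 2 (f i) z, partial 1 (f i) z])"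
  have smX: "smooth_on V (X i)" if i: "i \<in> {1..4}" for i
  proof -
    have "smooth_on (U i) (f i)"
      using U[OF i] by (simp add: first_integral_def)
    then have "smooth_on V (f i)"
      using VU[OF _ i] by (auto elim: smooth_on_subset)
    then show ?thesis
      unfolding smooth_on_vec_iff[OF V(1)] forall_2
      by (simp add: X_def smooth_on_partial smooth_on_minus V(1))
  qed
  have par: "wedge (X i (\<gamma> t)) (velocity \<gamma> t) = 0" "\<exists>k. velocity \<gamma> t = k *\<^sub>R X i (\<gamma> t)"
    if i: "i \<in> {1..4}" and c: "L \<in> \<F> i" "open T" "smooth_on T \<gamma>" "\<gamma> ` T \<subseteq> L" "t \<in> T" and v: "\<gamma> t \<in> V"
    for i L T \<gamma> t
  proof -
    let ?d1 = "partial 1 (f i) (\<gamma> t)" and ?d2 = "partial 2 (f i) (\<gamma> t)" and ?v = "velocity \<gamma> t"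
    have 0: "?d1 * ?v $ 1 + ?d2 * ?v $ 2 = 0"
      using first[OF i c] VU[OF v i] by simp
    then show "wedge (X i (\<gamma> t)) (velocity \<gamma> t) = 0"
      by (simp add: wedge_def X_def algebra_simps)
    have "?v = (if ?d1 \<noteq> 0 then ?v $ 2 / ?d1 else - ?v $ 1 / ?d2) *\<^sub>R X i (\<gamma> t)"
      using 0 nz[OF i VU[OF v i]] by (auto simp: vec_eq_iff forall_2 X_def field_simps)
    then show "\<exists>k. velocity \<gamma> t = k *\<^sub>R X i (\<gamma> t)"
      by blast
  qed
  have curve: "\<exists>L \<gamma> e. L \<in> \<F> i \<and> e > 0 \<and> geodesic_on {-e<..<e} g \<gamma> \<and> \<gamma> ` {-e<..<e} \<subseteq> L \<and> \<gamma> 0 = z \<and>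
      velocity \<gamma> 0 \<in> leaf_tangent (\<F> i) z - {0} \<and> (\<exists>k. velocity \<gamma> 0 = k *\<^sub>R X i z)"
    if i: "i \<in> {1..4}" and z: "z \<in> V" for i z
  proof -
    have "\<Union>(\<F> i) = W"
      using fol[OF i] by (simp add: foliation_def partition_on_def)
    then obtain L where L: "L \<in> \<F> i" "z \<in> L"
      using z V(3) by auto
    then have "geodesic_leaf g L"
      using geo i by (simp add: geodesic_web_def)
    then obtain \<gamma> e where \<gamma>: "e > 0" "geodesic_on {-e<..<e} g \<gamma>" "\<gamma> ` {-e<..<e} \<subseteq> L" "\<gamma> 0 = z"
      using L(2) unfolding geodesic_leaf_def by blast
    have v0: "velocity \<gamma> 0 \<noteq> 0" and sm: "smooth_on {-e<..<e} \<gamma>"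
      using \<gamma>(1,2) by (auto simp: geodesic_on_def)
    moreover have "velocity \<gamma> 0 \<in> leaf_tangent (\<F> i) z"
      unfolding leaf_tangent_def using L(1) \<gamma> sm by blast
    moreover have "\<exists>k. velocity \<gamma> 0 = k *\<^sub>R X i z"
      using par(2)[OF i L(1) _ sm \<gamma>(3), of 0] \<gamma>(1,4) z by simp
    ultimately show ?thesis
      using L(1) \<gamma> by blast
  qed
  have curves: "\<exists>v k. \<forall>i\<in>{1..4}. v i \<in> leaf_tangent (\<F> i) z - {0} \<and> v i = k i *\<^sub>R X i z" if z: "z \<in> V" for z
  proof -
    have "\<exists>v k. v \<in> leaf_tangent (\<F> i) z - {0} \<and> v = k *\<^sub>R X i z" if "i \<in> {1..4}" for i
      using curve[OF that z] by blast
    then show ?thesis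
      by metis
  qed
  have wne: "wedge (X i z) (X j z) \<noteq> 0" if ij: "i \<in> {1..4}" "j \<in> {1..4}" "i \<noteq> j" and z: "z \<in> V" for i j z
  proof
    assume w0: "wedge (X i z) (X j z) = 0"
    obtain v k where v: "\<And>i. i \<in> {1..4} \<Longrightarrow> v i \<in> leaf_tangent (\<F> i) z - {0}"
        "\<And>i. i \<in> {1..4} \<Longrightarrow> v i = k i *\<^sub>R X i z"
      using curves[OF z] by metis
    have w0: "wedge (v i) (v j) = 0"
      using w0 unfolding v(2)[OF ij(1)] v(2)[OF ij(2)] by (simp add: wedge_def algebra_simps)
    have "v i \<noteq> 0" "v j \<noteq> 0"
      using v(1) ij by auto
    then have "v j = (if v i $ 1 \<noteq> 0 then v j $ 1 / v i $ 1 else v j $ 2 / v i $ 2) *\<^sub>R v i"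
      using w0 by (auto simp: vec_eq_iff forall_2 wedge_def field_simps)
    then have "v j \<in> leaf_tangent (\<F> i) z"
      using leaf_tangent_scale v(1)[OF ij(1)] by (metis DiffD1)
    moreover have "leaf_tangent (\<F> i) z \<inter> leaf_tangent (\<F> j) z = {0}"
      using web[unfolded nakai_web_def four_web_def, THEN conjunct1, THEN conjunct2, rule_format, OF _ ij]
        subsetD[OF V(3) z] by (rule meta_mp)
    ultimately show False
      using v(1)[OF ij(2)] by blast
  qed
  obtain r where r: "\<forall>z\<in>W. \<forall>v. (\<forall>i\<in>{1..4}. v i \<in> leaf_tangent (\<F> i) z - {0}) \<longrightarrow>
        cross_ratio (v 1) (v 2) (v 3) (v 4) = r"
    using web[unfolded nakai_web_def, THEN conjunct2] by (rule exE)
  have cr: "wedge (X 1 z) (X 3 z) * wedge (X 2 z) (X 4 z) = r * (wedge (X 1 z) (X 4 z) * wedge (X 2 z) (X 3 z))"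
    if z: "z \<in> V" for z
  proof -
    obtain v k where v: "\<forall>i\<in>{1..4}. v i \<in> leaf_tangent (\<F> i) z - {0}"
        "\<And>i. i \<in> {1..4} \<Longrightarrow> v i = k i *\<^sub>R X i z"
      using curves[OF z] by metis
    have "k i \<noteq> 0" if "i \<in> {1..4}" for i
    proof
      assume "k i = 0"
      then have "v i = 0"
        using v(2)[OF that] by simp
      then show False
        using v(1) that by blast
    qed
    then have "cross_ratio (v 1) (v 2) (v 3) (v 4) = cross_ratio (X 1 z) (X 2 z) (X 3 z) (X 4 z)"
      by (simp add: v(2) cross_ratio_scale)
    moreover have "cross_ratio (v 1) (v 2) (v 3) (v 4) = r"
      using r[rule_format, OF subsetD[OF V(3) z]] v(1) by simp
    ultimately have "cross_ratio (X 1 z) (X 2 z) (X 3 z) (X 4 z) = r"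
      by simp
    moreover have "wedge (X 1 z) (X 4 z) * wedge (X 2 z) (X 3 z) \<noteq> 0"
      using wne[OF _ _ _ z, of 1 4] wne[OF _ _ _ z, of 2 3] by simp
    ultimately show ?thesis
      unfolding cross_ratio_def by (simp only: divide_eq_eq if_False simp_thms)
  qed
  define A where "A = (\<lambda>z. - wedge (X 2 z) (X 3 z) * (g z *v X 1 z) $ 2)"
  define B where "B = (\<lambda>z. wedge (X 2 z) (X 3 z) * (g z *v X 1 z) $ 1)"
  define C where "C = (\<lambda>z. - wedge (X 1 z) (X 3 z) * (g z *v X 2 z) $ 2)"
  define E where "E = (\<lambda>z. wedge (X 1 z) (X 3 z) * (g z *v X 2 z) $ 1)"
  have num: "A z * (g z *v v) $ 1 + B z * (g z *v v) $ 2 = gdet z * (wedge (X 2 z) (X 3 z) * wedge (X 1 z) v)"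
    and den: "C z * (g z *v v) $ 1 + E z * (g z *v v) $ 2 = gdet z * (wedge (X 1 z) (X 3 z) * wedge (X 2 z) v)"
    if "z \<in> V" for z v
  proof -
    have "A z * (g z *v v) $ 1 + B z * (g z *v v) $ 2 = wedge (X 2 z) (X 3 z) * wedge (g z *v X 1 z) (g z *v v)"
      "C z * (g z *v v) $ 1 + E z * (g z *v v) $ 2 = wedge (X 1 z) (X 3 z) * wedge (g z *v X 2 z) (g z *v v)"
      by (simp_all add: A_def B_def C_def E_def wedge_def[of "g z *v _"] algebra_simps)
    then show "A z * (g z *v v) $ 1 + B z * (g z *v v) $ 2 = gdet z * (wedge (X 2 z) (X 3 z) * wedge (X 1 z) v)"
      "C z * (g z *v v) $ 1 + E z * (g z *v v) $ 2 = gdet z * (wedge (X 1 z) (X 3 z) * wedge (X 2 z) v)"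
      using wedge_flat[OF subsetD[OF V(3) that]] by simp_all
  qed
  have sm: "smooth_on V A" "smooth_on V B" "smooth_on V C" "smooth_on V E"
    unfolding A_def B_def C_def E_def
    by (intro smooth_on_mult smooth_on_minus smooth_on_wedge smX V(1)
        smooth_on_linear[OF V(1) bounded_linear_vec_nth V.smooth_flat]; simp)+
  have nondeg: "A z * E z - B z * C z \<noteq> 0" if z: "z \<in> V" for z
  proof -
    have "A z * E z - B z * C z = wedge (X 2 z) (X 3 z) * wedge (X 1 z) (X 3 z) * wedge (g z *v X 1 z) (g z *v X 2 z)"
      by (simp add: A_def B_def C_def E_def wedge_def[of "g z *v _"] algebra_simps)
    then show ?thesis
      using z V(3) gdet_pos[of z] wne[of 2 3 z] wne[of 1 3 z] wne[of 1 2 z] by (auto simp: wedge_flat)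
  qed
  \<comment> \<open>The value of \<open>N / M\<close> on the \<open>i\<close>-th foliation, as the projective point \<open>- \<mu> i : \<kappa> i\<close>.\<close>
  define \<kappa> :: "nat \<Rightarrow> real" where "\<kappa> = (\<lambda>i. if i = 1 then 1 else if i = 2 then 0 else if i = 3 then 1 else r)"
  define \<mu> :: "nat \<Rightarrow> real" where "\<mu> = (\<lambda>i. if i = 1 then 0 else if i = 2 then 1 else - 1)"
  have rel: "\<kappa> i * (wedge (X 2 z) (X 3 z) * wedge (X 1 z) (X i z)) + \<mu> i * (wedge (X 1 z) (X 3 z) * wedge (X 2 z) (X i z)) = 0"
    if "i \<in> {1..4}" "z \<in> V" for i z
  proof -
    consider "i = 1" | "i = 2" | "i = 3" | "i = 4"
      using \<open>i \<in> {1..4}\<close> by fastforce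
    then show ?thesis
      using cr[OF \<open>z \<in> V\<close>] by cases (auto simp: \<kappa>_def \<mu>_def wedge_self algebra_simps)
  qed
  \<comment> \<open>The cubic form of \<open>poisson_fractional_linear\<close>.\<close>
  define T where "T = (\<lambda>z v. lin_bracket g A B z v * (C z * (g z *v v) $ 1 + E z * (g z *v v) $ 2)
      - (A z * (g z *v v) $ 1 + B z * (g z *v v) $ 2) * lin_bracket g C E z v)"
  \<comment> \<open>Differentiating \<open>\<kappa> N + \<mu> M = 0\<close> along a leaf geodesic gives the same relation for the brackets.\<close>
  have T0: "\<exists>v. T z v = 0 \<and> (\<exists>k. k \<noteq> 0 \<and> v = k *\<^sub>R X i z)" if i: "i \<in> {1..4}" and z: "z \<in> V" for i z
  proof -
    obtain L \<gamma> e k where L: "L \<in> \<F> i" "e > 0" "geodesic_on {-e<..<e} g \<gamma>" "\<gamma> ` {-e<..<e} \<subseteq> L" "\<gamma> 0 = z"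
      "velocity \<gamma> 0 \<noteq> 0" "velocity \<gamma> 0 = k *\<^sub>R X i z"
      using curve[OF i z] by blast
    let ?v = "velocity \<gamma> 0"
    let ?N = "\<lambda>t. A (\<gamma> t) * (g (\<gamma> t) *v velocity \<gamma> t) $ 1 + B (\<gamma> t) * (g (\<gamma> t) *v velocity \<gamma> t) $ 2"
    let ?M = "\<lambda>t. C (\<gamma> t) * (g (\<gamma> t) *v velocity \<gamma> t) $ 1 + E (\<gamma> t) * (g (\<gamma> t) *v velocity \<gamma> t) $ 2"
    have smg: "smooth_on {-e<..<e} \<gamma>"
      using L(3) by (simp add: geodesic_on_def)
    have rel0: "\<kappa> i * ?N t + \<mu> i * ?M t = 0" if t: "t \<in> {-e<..<e}" "\<gamma> t \<in> V" for t
    proof -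
      obtain k where k: "velocity \<gamma> t = k *\<^sub>R X i (\<gamma> t)"
        using par(2)[OF i L(1) _ smg L(4) t] by auto
      have s: "wedge u (k *\<^sub>R v) = k * wedge u v" for u v
        by (simp add: wedge_def algebra_simps)
      have "\<kappa> i * ?N t + \<mu> i * ?M t = gdet (\<gamma> t) * k * (\<kappa> i * (wedge (X 2 (\<gamma> t)) (X 3 (\<gamma> t)) * wedge (X 1 (\<gamma> t)) (X i (\<gamma> t)))
          + \<mu> i * (wedge (X 1 (\<gamma> t)) (X 3 (\<gamma> t)) * wedge (X 2 (\<gamma> t)) (X i (\<gamma> t))))"
        unfolding num[OF t(2)] den[OF t(2)] k s by (simp add: algebra_simps)
      then show ?thesis
        using rel[OF i t(2)] by simp
    qed
    have z': "\<gamma> 0 \<in> V"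
      using z L(5) by simp
    have N': "(?N has_real_derivative lin_bracket g A B z ?v) (at 0)"
      using V.bracket_along_geodesic[OF _ _ L(3) z', of A B] L(2,5) sm[THEN smooth_on_differentiable, OF z] by simp
    have M': "(?M has_real_derivative lin_bracket g C E z ?v) (at 0)"
      using V.bracket_along_geodesic[OF _ _ L(3) z', of C E] L(2,5) sm[THEN smooth_on_differentiable, OF z] by simp
    have "((\<lambda>t. \<kappa> i * ?N t + \<mu> i * ?M t) has_real_derivative
        \<kappa> i * lin_bracket g A B z ?v + \<mu> i * lin_bracket g C E z ?v) (at 0)"
      by (intro DERIV_add DERIV_cmult N' M')
    moreover have "((\<lambda>t. \<kappa> i * ?N t + \<mu> i * ?M t) has_real_derivative 0) (at 0)"
    proof (rule has_field_derivative_transform_within_open[OF DERIV_const])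
      show "open (\<gamma> -` V \<inter> {-e<..<e})"
        using smooth_on_continuous[OF smg] V(1) by (simp add: continuous_on_open_vimage)
      show "0 \<in> \<gamma> -` V \<inter> {-e<..<e}"
        using z' L(2) by simp
      show "0 = \<kappa> i * ?N t + \<mu> i * ?M t" if "t \<in> \<gamma> -` V \<inter> {-e<..<e}" for t
        using rel0[of t] that by simp
    qed
    ultimately have lb: "\<kappa> i * lin_bracket g A B z ?v + \<mu> i * lin_bracket g C E z ?v = 0"
      using DERIV_unique by blast
    have "\<kappa> i * (A z * (g z *v ?v) $ 1 + B z * (g z *v ?v) $ 2) + \<mu> i * (C z * (g z *v ?v) $ 1 + E z * (g z *v ?v) $ 2) = 0"
      using rel0[of 0] L(2,5) z by simp
    moreover have "\<kappa> i \<noteq> 0 \<or> \<mu> i \<noteq> 0"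
      by (auto simp: \<kappa>_def \<mu>_def)
    moreover have "\<kappa> i * T z ?v = 0" "\<mu> i * T z ?v = 0"
      using lb calculation(1) unfolding T_def by algebra+
    ultimately have "T z ?v = 0"
      by auto
    then show ?thesis
      using L(6,7) by fastforce
  qed
  have T: "T z y = 0" if z: "z \<in> V" for z y
  proof -
    obtain v k where v: "\<And>i. i \<in> {1..4} \<Longrightarrow> T z (v i) = 0" "\<And>i. i \<in> {1..4} \<Longrightarrow> k i \<noteq> 0 \<and> v i = k i *\<^sub>R X i z"
      using T0[OF _ z] by metis
    have w: "wedge (v i) (v j) \<noteq> 0" if "i \<in> {1..4}" "j \<in> {1..4}" "i \<noteq> j" for i j
    proof -
      have "wedge (v i) (v j) = k i * k j * wedge (X i z) (X j z)"
        using v(2) that by (simp add: wedge_def algebra_simps)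
      then show ?thesis
        using v(2) that wne[OF that z] by simp
    qed
    define q1 q2 q3 where "q1 = lin_bracket g A B z (axis 1 1)"
      "q2 = lin_bracket g A B z (axis 1 1 + axis 2 1) - lin_bracket g A B z (axis 1 1) - lin_bracket g A B z (axis 2 1)"
      "q3 = lin_bracket g A B z (axis 2 1)"
    define s1 s2 s3 where "s1 = lin_bracket g C E z (axis 1 1)"
      "s2 = lin_bracket g C E z (axis 1 1 + axis 2 1) - lin_bracket g C E z (axis 1 1) - lin_bracket g C E z (axis 2 1)"
      "s3 = lin_bracket g C E z (axis 2 1)"
    define m1 m2 n1 n2 where "m1 = C z * g z $ 1 $ 1 + E z * g z $ 2 $ 1" "m2 = C z * g z $ 1 $ 2 + E z * g z $ 2 $ 2"
      "n1 = A z * g z $ 1 $ 1 + B z * g z $ 2 $ 1" "n2 = A z * g z $ 1 $ 2 + B z * g z $ 2 $ 2"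
    have q: "lin_bracket g A B z y = q1 * y $ 1 ^ 2 + q2 * y $ 1 * y $ 2 + q3 * y $ 2 ^ 2" for y
      unfolding q1_q2_q3_def by (rule lin_bracket_quadratic)
    have s: "lin_bracket g C E z y = s1 * y $ 1 ^ 2 + s2 * y $ 1 * y $ 2 + s3 * y $ 2 ^ 2" for y
      unfolding s1_s2_s3_def by (rule lin_bracket_quadratic)
    have m: "C z * (g z *v y) $ 1 + E z * (g z *v y) $ 2 = m1 * y $ 1 + m2 * y $ 2"
      "A z * (g z *v y) $ 1 + B z * (g z *v y) $ 2 = n1 * y $ 1 + n2 * y $ 2" for y
      by (simp_all add: mv2 m1_m2_n1_n2_def algebra_simps)
    have "T z y = (q1 * y $ 1 ^ 2 + q2 * y $ 1 * y $ 2 + q3 * y $ 2 ^ 2) * (m1 * y $ 1 + m2 * y $ 2)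
       - (n1 * y $ 1 + n2 * y $ 2) * (s1 * y $ 1 ^ 2 + s2 * y $ 1 * y $ 2 + s3 * y $ 2 ^ 2)" for y
      unfolding T_def q s m ..
    then have cubic: "T z y = (q1 * m1 - n1 * s1) * y $ 1 ^ 3
       + (q1 * m2 + q2 * m1 - n1 * s2 - n2 * s1) * y $ 1 ^ 2 * y $ 2
       + (q2 * m2 + q3 * m1 - n1 * s3 - n2 * s2) * y $ 1 * y $ 2 ^ 2
       + (q3 * m2 - n2 * s3) * y $ 2 ^ 3" for y
      by (simp add: algebra_simps power2_eq_square power3_eq_cube)
    show ?thesis
      unfolding cubic
      by (rule binary_cubic_zero[where u = "v 1" and v = "v 2" and w = "v 3" and x = "v 4"])
        (use v(1) w in \<open>auto simp: cubic[symmetric]\<close>)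
  qed
  have "fractional_linear_integral V g A B C E"
    unfolding fractional_linear_integral_def
  proof (intro conjI sm ballI allI impI)
    show "A z * E z - B z * C z \<noteq> 0" if "z \<in> V" for z
      by (rule nondeg[OF that])
    show "poisson (fractional_linear A B C E) (geodesic_hamiltonian g) (z, p) = 0"
      if z: "z \<in> V" and M: "C z * p $ 1 + E z * p $ 2 \<noteq> 0" for z p
      using V.poisson_fractional_linear[OF z sm[THEN smooth_on_differentiable, OF z] M]
        T[OF z, of "V.sharp z p"] by (simp add: T_def V.flat_sharp[OF z])
  qed
  then show ?thesis
    using V by blast
qed

section \<open>Potentials of closed forms\<close>

lemma blinfun_inner_left_apply: "blinfun_apply (blinfun_inner_left x) y = y \<bullet> x"
  by transfer (rule refl)

lemma has_derivative_components:
  fixes \<beta> :: "real^2 \<Rightarrow> real^2"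
  assumes "\<beta> differentiable (at z)"
  shows "(\<beta> has_derivative (\<lambda>h. vector
    [partial 1 (\<lambda>x. \<beta> x $ 1) z * h $ 1 + partial 2 (\<lambda>x. \<beta> x $ 1) z * h $ 2,
     partial 1 (\<lambda>x. \<beta> x $ 2) z * h $ 1 + partial 2 (\<lambda>x. \<beta> x $ 2) z * h $ 2])) (at z)"
proof -
  obtain D where D: "(\<beta> has_derivative D) (at z)"
    using assms unfolding differentiable_def by blast
  have c: "((\<lambda>x. \<beta> x $ i) has_derivative (\<lambda>h. D h $ i)) (at z)" for i
    by (rule bounded_linear.has_derivative[OF bounded_linear_vec_nth D])
  have e: "(\<lambda>h. D h $ i) = (\<lambda>h. partial 1 (\<lambda>x. \<beta> x $ i) z * h $ 1 + partial 2 (\<lambda>x. \<beta> x $ i) z * h $ 2)" for i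
  proof (rule has_derivative_unique[OF c])
    have "(\<lambda>x. \<beta> x $ i) differentiable (at z)"
      using c unfolding differentiable_def by blast
    then show "((\<lambda>x. \<beta> x $ i) has_derivative
        (\<lambda>h. partial 1 (\<lambda>x. \<beta> x $ i) z * h $ 1 + partial 2 (\<lambda>x. \<beta> x $ i) z * h $ 2)) (at z)"
      by (rule has_derivative_partial)
  qed
  show ?thesis
    by (rule has_derivative_eq_rhs[OF D]) (simp add: fun_eq_iff vec_eq_iff forall_2 fun_cong[OF e])
qed

text \<open>The Poincare lemma. The potential integrates \<open>\<beta>\<close> along the segments from \<open>z\<^sub>0\<close>. Since the derivative of a
  closed form is symmetric, differentiating the integrand with respect to the endpoint gives the
  \<open>t\<close>-derivative of \<open>t \<beta>(z\<^sub>0 + t (x - z\<^sub>0))\<close>.\<close>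

lemma closed_form_has_potential:
  fixes \<beta> :: "real^2 \<Rightarrow> real^2"
  assumes "open B" "convex B" "z\<^sub>0 \<in> B" and sm: "smooth_on B \<beta>"
    and closed: "\<And>z. z \<in> B \<Longrightarrow> partial 1 (\<lambda>x. \<beta> x $ 2) z = partial 2 (\<lambda>x. \<beta> x $ 1) z"
  obtains w where "smooth_on B w" "\<forall>z\<in>B. (w has_derivative (\<lambda>v. \<beta> z \<bullet> v)) (at z)"
proof -
  define D :: "real^2 \<Rightarrow> real^2 \<Rightarrow> real^2" where "D = (\<lambda>z h. vector
    [partial 1 (\<lambda>x. \<beta> x $ 1) z * h $ 1 + partial 2 (\<lambda>x. \<beta> x $ 1) z * h $ 2,
     partial 1 (\<lambda>x. \<beta> x $ 2) z * h $ 1 + partial 2 (\<lambda>x. \<beta> x $ 2) z * h $ 2])"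
  have D: "(\<beta> has_derivative D z) (at z)" if "z \<in> B" for z
    unfolding D_def by (rule has_derivative_components[OF smooth_on_differentiable[OF sm that]])
  have sym: "D z h \<bullet> k = D z k \<bullet> h" if "z \<in> B" for z h k
    by (simp add: D_def inner_vec_def sum_2 closed[OF that] algebra_simps)
  define y where "y = (\<lambda>x t. z\<^sub>0 + t *\<^sub>R (x - z\<^sub>0))"
  have yB: "y x t \<in> B" if "x \<in> B" "t \<in> {0..1}" for x t
  proof -
    have "(1 - t) *\<^sub>R z\<^sub>0 + t *\<^sub>R x \<in> B"
      using that \<open>convex B\<close> \<open>z\<^sub>0 \<in> B\<close> by (intro convexD) auto
    then show ?thesis
      by (simp add: y_def algebra_simps)
  qed
  define c where "c = (\<lambda>x t. t *\<^sub>R D (y x t) (x - z\<^sub>0) + \<beta> (y x t))"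
  define w where "w = (\<lambda>x. integral (cbox 0 1) (\<lambda>t. \<beta> (y x t) \<bullet> (x - z\<^sub>0)))"
  have cont\<beta>: "continuous_on B \<beta>"
    by (rule smooth_on_continuous[OF sm])
  have sm\<beta>: "smooth_on B (\<lambda>z. \<beta> z $ i)" for i
    using sm \<open>open B\<close> by (simp add: smooth_on_vec_iff)
  have contp: "continuous_on B (partial j (\<lambda>z. \<beta> z $ i))" for i j
    by (intro smooth_on_continuous smooth_on_partial sm\<beta>)
  have conty: "continuous_on (B \<times> {0..1}) (\<lambda>p. y (fst p) (snd p))"
    unfolding y_def by (intro continuous_intros)
  have comp: "continuous_on (B \<times> {0..1}) (\<lambda>p. h (y (fst p) (snd p)))" if "continuous_on B h"
    for h :: "real^2 \<Rightarrow> 'b::real_normed_vector"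
    by (rule continuous_on_compose2[OF that conty]) (use yB in auto)
  have contc: "continuous_on (B \<times> {0..1}) (\<lambda>p. c (fst p) (snd p))"
  proof -
    have "D z h = h $ 1 *\<^sub>R vector [partial 1 (\<lambda>x. \<beta> x $ 1) z, partial 1 (\<lambda>x. \<beta> x $ 2) z]
        + h $ 2 *\<^sub>R vector [partial 2 (\<lambda>x. \<beta> x $ 1) z, partial 2 (\<lambda>x. \<beta> x $ 2) z]" for z h
      by (simp add: D_def vec_eq_iff forall_2 algebra_simps)
    moreover have "continuous_on B (\<lambda>z. vector [partial j (\<lambda>x. \<beta> x $ 1) z, partial j (\<lambda>x. \<beta> x $ 2) z] :: real^2)" for j
    proof -
      have "vector [s, t] = (s *\<^sub>R axis 1 1 + t *\<^sub>R axis 2 1 :: real^2)" for s t :: real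
        by (simp add: vec_eq_iff forall_2 axis_def)
      then show ?thesis
        by (auto intro!: continuous_intros contp)
    qed
    ultimately show ?thesis
      unfolding c_def by (auto intro!: continuous_intros comp cont\<beta>)
  qed
  have w: "(w has_derivative (\<lambda>v. \<beta> x \<bullet> v)) (at x)" if x: "x \<in> B" for x
  proof -
    have deriv: "((\<lambda>x. \<beta> (y x t) \<bullet> (x - z\<^sub>0)) has_derivative blinfun_apply (blinfun_inner_left (c x t))) (at x within B)"
      if x: "x \<in> B" and t: "t \<in> cbox 0 1" for x t
    proof -
      have "((\<lambda>x. y x t) has_derivative (\<lambda>h. t *\<^sub>R h)) (at x within B)"
        unfolding y_def by (auto intro!: derivative_eq_intros)
      then have "((\<lambda>x. \<beta> (y x t)) has_derivative (\<lambda>h. D (y x t) (t *\<^sub>R h))) (at x within B)"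
        by (rule has_derivative_compose) (use D yB x t in auto)
      then have "((\<lambda>x. \<beta> (y x t) \<bullet> (x - z\<^sub>0)) has_derivative
          (\<lambda>h. \<beta> (y x t) \<bullet> (h - 0) + D (y x t) (t *\<^sub>R h) \<bullet> (x - z\<^sub>0))) (at x within B)"
        by (intro has_derivative_inner has_derivative_diff has_derivative_ident has_derivative_const)
      then show ?thesis
      proof (rule has_derivative_eq_rhs)
        have "D (y x t) (t *\<^sub>R h) \<bullet> (x - z\<^sub>0) = D (y x t) (x - z\<^sub>0) \<bullet> (t *\<^sub>R h)" for h
          by (rule sym) (use yB x t in auto)
        then show "(\<lambda>h. \<beta> (y x t) \<bullet> (h - 0) + D (y x t) (t *\<^sub>R h) \<bullet> (x - z\<^sub>0)) = blinfun_apply (blinfun_inner_left (c x t))"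
          by (simp add: fun_eq_iff blinfun_inner_left_apply c_def inner_add_right inner_commute)
      qed
    qed
    have slice: "continuous_on {0..1} (\<lambda>t. \<beta> (y x t))" if "x \<in> B" for x
      by (rule continuous_on_compose2[OF cont\<beta>]) (use yB that in \<open>auto simp: y_def intro!: continuous_intros\<close>)
    have "((\<lambda>x. integral (cbox 0 1) (\<lambda>t. \<beta> (y x t) \<bullet> (x - z\<^sub>0))) has_derivative
        integral (cbox 0 1) (\<lambda>t. blinfun_inner_left (c x t))) (at x within B)"
    proof (rule leibniz_rule[OF deriv _ _ x \<open>convex B\<close>])
      show "(\<lambda>t. \<beta> (y x t) \<bullet> (x - z\<^sub>0)) integrable_on cbox 0 1" if "x \<in> B" for x
        using slice[OF that] by (intro integrable_continuous continuous_intros) simp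
      show "continuous_on (B \<times> cbox 0 1) (\<lambda>(x, t). blinfun_inner_left (c x t))"
        using bounded_linear.continuous_on[OF bounded_linear_blinfun_inner_left contc] by (simp add: split_beta)
    qed auto
    moreover have "((\<lambda>t. blinfun_inner_left (c x t)) has_integral
        (blinfun_inner_left (1 *\<^sub>R \<beta> (y x 1)) - blinfun_inner_left (0 *\<^sub>R \<beta> (y x 0)))) {0..1}"
    proof (rule fundamental_theorem_of_calculus)
      fix t :: real assume t: "t \<in> {0..1}"
      have "((\<lambda>t. y x t) has_derivative (\<lambda>s. s *\<^sub>R (x - z\<^sub>0))) (at t within {0..1})"
        unfolding y_def by (auto intro!: derivative_eq_intros)
      then have "((\<lambda>t. \<beta> (y x t)) has_derivative (\<lambda>s. D (y x t) (s *\<^sub>R (x - z\<^sub>0)))) (at t within {0..1})"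
        by (rule has_derivative_compose) (use D yB x t in auto)
      moreover have "D (y x t) (s *\<^sub>R (x - z\<^sub>0)) = s *\<^sub>R D (y x t) (x - z\<^sub>0)" for s
        by (simp add: D_def vec_eq_iff forall_2 algebra_simps)
      ultimately have "((\<lambda>t. \<beta> (y x t)) has_vector_derivative D (y x t) (x - z\<^sub>0)) (at t within {0..1})"
        by (simp add: has_vector_derivative_def)
      from has_vector_derivative_scaleR[OF DERIV_ident this]
      have "((\<lambda>t. t *\<^sub>R \<beta> (y x t)) has_vector_derivative c x t) (at t within {0..1})"
        by (simp add: c_def)
      then show "((\<lambda>t. blinfun_inner_left (t *\<^sub>R \<beta> (y x t))) has_vector_derivative blinfun_inner_left (c x t)) (at t within {0..1})"
        by (rule bounded_linear.has_vector_derivative[OF bounded_linear_blinfun_inner_left])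
    qed simp
    then have "integral (cbox 0 1) (\<lambda>t. blinfun_inner_left (c x t)) = blinfun_inner_left (\<beta> x)"
      by (simp add: y_def integral_unique linear_0[OF bounded_linear.linear[OF bounded_linear_blinfun_inner_left]])
    ultimately have "(w has_derivative blinfun_apply (blinfun_inner_left (\<beta> x))) (at x)"
      using x \<open>open B\<close> unfolding w_def by (simp only: at_within_open)
    then show ?thesis
      by (rule has_derivative_eq_rhs) (simp add: fun_eq_iff blinfun_inner_left_apply inner_commute)
  qed
  show thesis
  proof (rule that)
    show "\<forall>z\<in>B. (w has_derivative (\<lambda>v. \<beta> z \<bullet> v)) (at z)"
      by (intro ballI w)
    show "smooth_on B w"
      by (rule smooth_on_has_derivative[OF \<open>open B\<close> w])
        (auto intro: smooth_on_linear[OF \<open>open B\<close> bounded_linear_inner_left sm])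
  qed
qed

section \<open>Foliations with a dual frame\<close>

text \<open>If the derivative of \<open>\<psi>\<close> is expressed by smooth fields evaluated along \<open>\<psi>\<close>, then each degree of smoothness
  of \<open>\<psi>\<close> gives the next one. For the inverse of a map this replaces the inversion of Jacobi matrices.\<close>

lemma smooth_on_of_frame:
  fixes \<psi> :: "real^2 \<Rightarrow> real^2"
  assumes "open S" "open B" "\<psi> ` S \<subseteq> B" "smooth_on B X" "smooth_on B Y"
    and \<psi>: "\<And>y. y \<in> S \<Longrightarrow> (\<psi> has_derivative (\<lambda>v. v $ 1 *\<^sub>R X (\<psi> y) + v $ 2 *\<^sub>R Y (\<psi> y))) (at y)"
  shows "smooth_on S \<psi>"
proof -
  have "Ck_on k S \<psi>" for k
  proof (induction k)
    case 0
    show ?case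
      unfolding Ck_on.simps by (intro continuous_at_imp_continuous_on ballI has_derivative_continuous[OF \<psi>])
  next
    case (Suc k)
    have c: "Ck_on k S (\<lambda>y. r *\<^sub>R Z (\<psi> y))" if "smooth_on B Z" for r and Z :: "real^2 \<Rightarrow> real^2"
    proof -
      have "Ck_on k B Z"
        using that by (simp only: smooth_on_def)
      from Ck_on_compose[OF \<open>open S\<close> assms(3) this Suc] show ?thesis
        by (rule Ck_on_linear[OF \<open>open S\<close> bounded_linear_scaleR_right])
    qed
    show ?case
      by (intro Ck_on_Suc_has_derivative[OF \<open>open S\<close> \<psi>] Ck_on_add \<open>open S\<close> c assms(4,5))
  qed
  then show ?thesis
    by (simp add: smooth_on_def)
qed

text \<open>Functions \<open>u\<close> and \<open>w\<close> whose differentials \<open>\<alpha>\<close>, \<open>\<beta>\<close> have a dual frame \<open>X\<close>, \<open>Y\<close>. The flow lines of \<open>X\<close> are the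
  level curves of \<open>w\<close>, parametrized by \<open>u\<close>.\<close>

locale framed_map =
  fixes B :: "(real^2) set" and u w :: "real^2 \<Rightarrow> real" and \<alpha> \<beta> X Y :: "real^2 \<Rightarrow> real^2"
  assumes open_B: "open B"
    and sm: "smooth_on B u" "smooth_on B w" "smooth_on B X" "smooth_on B Y"
    and sm_form: "smooth_on B \<alpha>" "smooth_on B \<beta>"
    and du: "\<And>z. z \<in> B \<Longrightarrow> (u has_derivative (\<lambda>v. \<alpha> z \<bullet> v)) (at z)"
    and dw: "\<And>z. z \<in> B \<Longrightarrow> (w has_derivative (\<lambda>v. \<beta> z \<bullet> v)) (at z)"
    and dual: "\<And>z. z \<in> B \<Longrightarrow> \<alpha> z \<bullet> X z = 1" "\<And>z. z \<in> B \<Longrightarrow> \<alpha> z \<bullet> Y z = 0"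
      "\<And>z. z \<in> B \<Longrightarrow> \<beta> z \<bullet> X z = 0" "\<And>z. z \<in> B \<Longrightarrow> \<beta> z \<bullet> Y z = 1"
begin

definition \<phi> :: "real^2 \<Rightarrow> real^2" where "\<phi> z = vector [u z, w z]"

text \<open>A level set of \<open>w\<close> may be disconnected, for instance where the domain bends around; leaves have to be
  connected.\<close>

definition leaf :: "real^2 \<Rightarrow> (real^2) set" where
  "leaf z = path_component_set {y\<in>B. w y = w z} z"

lemma frame_expansion:
  assumes "z \<in> B"
  shows "(\<alpha> z \<bullet> v) *\<^sub>R X z + (\<beta> z \<bullet> v) *\<^sub>R Y z = v"
proof -
  let ?f = "\<lambda>v. vector [\<alpha> z \<bullet> v, \<beta> z \<bullet> v] :: real^2" and ?g = "\<lambda>v :: real^2. v $ 1 *\<^sub>R X z + v $ 2 *\<^sub>R Y z"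
  have "linear ?f" "linear ?g"
    by (rule linearI; simp add: vec_eq_iff forall_2 inner_add_right algebra_simps)+
  then have "?f \<circ> ?g = id \<longleftrightarrow> ?g \<circ> ?f = id"
    by (rule linear_inverse_left)
  moreover have "?f \<circ> ?g = id"
    using dual[OF assms] by (simp add: fun_eq_iff vec_eq_iff forall_2 inner_add_right)
  ultimately have "?g \<circ> ?f = id"
    by (rule iffD1)
  from fun_cong[OF this, of v] show ?thesis
    by simp
qed

lemma has_derivative_\<phi>:
  assumes "z \<in> B"
  shows "(\<phi> has_derivative (\<lambda>v. vector [\<alpha> z \<bullet> v, \<beta> z \<bullet> v])) (at z)"
proof -
  have v: "vector [s, t] = (s *\<^sub>R axis 1 1 + t *\<^sub>R axis 2 1 :: real^2)" for s t :: real
    by (simp add: vec_eq_iff forall_2 axis_def)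
  show ?thesis
    unfolding \<phi>_def[abs_def] v
    by (intro has_derivative_add has_derivative_scaleR_left du dw assms)
qed

text \<open>The inverse \<open>\<psi>\<close> is part of the data because it carries the integral curves: its first partial
  derivative is \<open>X\<close>.\<close>

definition flow_box :: "(real^2) set \<Rightarrow> real^2 \<Rightarrow> real^2 \<Rightarrow> (real^2 \<Rightarrow> real^2) \<Rightarrow> bool" where
  "flow_box V a b \<psi> \<longleftrightarrow> open V \<and> V \<subseteq> B \<and> diffeo_on V \<phi> \<and> \<phi> ` V = box a b \<and>
     (\<forall>x\<in>V. \<psi> (\<phi> x) = x) \<and> (\<forall>y\<in>box a b. \<psi> y \<in> V \<and> \<phi> (\<psi> y) = y) \<and> smooth_on (box a b) \<psi> \<and>
     (\<forall>y\<in>box a b. (\<psi> has_derivative (\<lambda>v. v $ 1 *\<^sub>R X (\<psi> y) + v $ 2 *\<^sub>R Y (\<psi> y))) (at y))"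

lemma flow_boxD:
  assumes "flow_box V a b \<psi>"
  shows "open V" "V \<subseteq> B" "diffeo_on V \<phi>" "\<phi> ` V = box a b" "x \<in> V \<Longrightarrow> \<psi> (\<phi> x) = x"
    "y \<in> box a b \<Longrightarrow> \<psi> y \<in> V" "y \<in> box a b \<Longrightarrow> \<phi> (\<psi> y) = y" "smooth_on (box a b) \<psi>"
    "y \<in> box a b \<Longrightarrow> (\<psi> has_derivative (\<lambda>v. v $ 1 *\<^sub>R X (\<psi> y) + v $ 2 *\<^sub>R Y (\<psi> y))) (at y)"
  using assms unfolding flow_box_def by (elim conjE; (assumption | erule (1) bspec | blast))+

lemma local_chart:
  assumes z: "z \<in> B"
  obtains V a b \<psi> where "z \<in> V" "flow_box V a b \<psi>"
proof -
  define f' where "f' = (\<lambda>z. Blinfun (\<lambda>v. vector [\<alpha> z \<bullet> v, \<beta> z \<bullet> v] :: real^2))"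
  have "bounded_linear (\<lambda>v. vector [\<alpha> z \<bullet> v, \<beta> z \<bullet> v] :: real^2)" for z
    unfolding linear_conv_bounded_linear[symmetric]
    by (rule linearI) (simp_all add: vec_eq_iff forall_2 inner_add_right)
  then have f': "blinfun_apply (f' z) = (\<lambda>v. vector [\<alpha> z \<bullet> v, \<beta> z \<bullet> v])" for z
    unfolding f'_def by (rule bounded_linear_Blinfun_apply)
  define h where "h = Blinfun (\<lambda>v :: real^2. v $ 1 *\<^sub>R X z + v $ 2 *\<^sub>R Y z)"
  have "bounded_linear (\<lambda>v :: real^2. v $ 1 *\<^sub>R X z + v $ 2 *\<^sub>R Y z)"
    unfolding linear_conv_bounded_linear[symmetric] by (rule linearI) (simp_all add: algebra_simps)
  then have h: "blinfun_apply h = (\<lambda>v. v $ 1 *\<^sub>R X z + v $ 2 *\<^sub>R Y z)"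
    unfolding h_def by (rule bounded_linear_Blinfun_apply)
  have inv: "h o\<^sub>L f' z = id_blinfun"
    by (rule blinfun_eqI) (simp add: h f' frame_expansion[OF z])
  have cont: "continuous_on B f'"
  proof (rule continuous_on_blinfun_componentwise)
    fix i :: "real^2"
    have v: "vector [s, t] = (s *\<^sub>R axis 1 1 + t *\<^sub>R axis 2 1 :: real^2)" for s t :: real
      by (simp add: vec_eq_iff forall_2 axis_def)
    show "continuous_on B (\<lambda>x. blinfun_apply (f' x) i)"
      unfolding f' v using sm_form[THEN smooth_on_continuous] by (intro continuous_intros)
  qed
  have deriv: "(\<phi> has_derivative blinfun_apply (f' x)) (at x)" if "x \<in> B" for x
    unfolding f' by (rule has_derivative_\<phi>[OF that])
  have "\<exists>U O' \<psi> \<psi>'. (open U \<and> U \<subseteq> B \<and> z \<in> U \<and> open O' \<and> \<phi> z \<in> O' \<and> homeomorphism U O' \<phi> \<psi>) \<and>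
      (\<forall>y\<in>O'. (\<psi> has_derivative \<psi>' y) (at y) \<and> \<psi>' y = inv (blinfun_apply (f' (\<psi> y))))"
    by (rule inverse_function_theorem[OF open_B deriv cont z inv]) blast+
  then obtain U O' \<psi> \<psi>' where U: "open U" "U \<subseteq> B" "z \<in> U" "open O'" "\<phi> z \<in> O'" "homeomorphism U O' \<phi> \<psi>"
    and \<psi>': "\<forall>y\<in>O'. (\<psi> has_derivative \<psi>' y) (at y) \<and> \<psi>' y = inv (blinfun_apply (f' (\<psi> y)))"
    by (elim exE conjE) (rule that)
  obtain e where e: "e > 0" "ball (\<phi> z) e \<subseteq> O'"
    using U(4,5) open_contains_ball by blast
  obtain a b where ab: "\<phi> z \<in> box a b" "box a b \<subseteq> ball (\<phi> z) e"
    using rational_boxes[OF e(1), of "\<phi> z"] by blast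
  define V where "V = U \<inter> \<phi> -` box a b"
  have boxO: "box a b \<subseteq> O'"
    using ab e by blast
  have \<psi>\<phi>: "\<psi> (\<phi> x) = x" if "x \<in> V" for x
    using U(6) that by (simp add: homeomorphism_def V_def)
  have \<phi>\<psi>: "\<psi> y \<in> V \<and> \<phi> (\<psi> y) = y" if "y \<in> box a b" for y
  proof -
    have "y \<in> O'"
      by (rule subsetD[OF boxO that])
    then have "\<psi> y \<in> U" "\<phi> (\<psi> y) = y"
      using U(6) unfolding homeomorphism_def by blast+
    then show ?thesis
      using that by (simp add: V_def)
  qed
  have "continuous_on U \<phi>"
    using U(6) by (simp add: homeomorphism_def)
  then have "open (\<phi> -` box a b \<inter> U)"
    using continuous_on_open_vimage[OF U(1), of \<phi>] open_box by blast
  then have "open V"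
    by (simp only: V_def Int_commute)
  have VB: "V \<subseteq> B"
    using U(2) by (auto simp: V_def)
  have "z \<in> V"
    using U(3) ab(1) by (simp add: V_def)
  have im: "\<phi> ` V = box a b"
  proof (intro equalityI subsetI)
    show "y \<in> box a b" if "y \<in> \<phi> ` V" for y
      using that by (auto simp: V_def)
    show "y \<in> \<phi> ` V" if "y \<in> box a b" for y
      by (rule image_eqI[of _ _ "\<psi> y"]) (simp_all only: \<phi>\<psi>[OF that])
  qed
  have d\<psi>: "(\<psi> has_derivative (\<lambda>v. v $ 1 *\<^sub>R X (\<psi> y) + v $ 2 *\<^sub>R Y (\<psi> y))) (at y)" if y: "y \<in> box a b" for y
  proof -
    have p: "\<psi> y \<in> B"
      using \<phi>\<psi>[OF y] VB by blast
    let ?g = "\<lambda>v :: real^2. v $ 1 *\<^sub>R X (\<psi> y) + v $ 2 *\<^sub>R Y (\<psi> y)"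
    have "blinfun_apply (f' (\<psi> y)) \<circ> ?g = id"
      unfolding f' using dual[OF p] by (simp add: fun_eq_iff vec_eq_iff forall_2 inner_add_right)
    moreover have "?g \<circ> blinfun_apply (f' (\<psi> y)) = id"
      unfolding f' using frame_expansion[OF p] by (simp add: fun_eq_iff)
    ultimately have "inv (blinfun_apply (f' (\<psi> y))) = ?g"
      by (rule inv_unique_comp)
    then have "\<psi>' y = ?g"
      using bspec[OF \<psi>' subsetD[OF boxO y]] by simp
    moreover have "(\<psi> has_derivative \<psi>' y) (at y)"
      using bspec[OF \<psi>' subsetD[OF boxO y]] by (rule conjunct1)
    ultimately show ?thesis
      by (simp only:)
  qed
  have sm\<psi>: "smooth_on (box a b) \<psi>"
    by (intro smooth_on_of_frame[OF open_box open_B _ sm(3,4) d\<psi>]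
      image_subsetI subsetD[OF VB] conjunct1[OF \<phi>\<psi>])
  have sm\<phi>: "smooth_on V \<phi>"
    unfolding smooth_on_vec_iff[OF \<open>open V\<close>] forall_2 \<phi>_def using sm(1,2) VB by (auto elim: smooth_on_subset)
  have inj: "inj_on \<phi> V"
    by (rule inj_on_inverseI[of V \<psi>]) (rule \<psi>\<phi>)
  have "inv_into V \<phi> y = \<psi> y" if "y \<in> box a b" for y
    using inv_into_f_f[OF inj, of "\<psi> y"] \<phi>\<psi>[OF that] by simp
  then have "smooth_on (box a b) (inv_into V \<phi>)"
    by (intro smooth_on_cong[OF open_box _ sm\<psi>]) simp
  then have "diffeo_on V \<phi>"
    using \<open>open V\<close> inj sm\<phi> unfolding diffeo_on_def im by (simp add: open_box)
  then have "flow_box V a b \<psi>"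
    unfolding flow_box_def using \<open>open V\<close> VB im sm\<psi>
    by (intro conjI ballI \<psi>\<phi> d\<psi> conjunct1[OF \<phi>\<psi>] conjunct2[OF \<phi>\<psi>])
  with \<open>z \<in> V\<close> show thesis
    by (rule that)
qed

lemma leaf_refl: "z \<in> B \<Longrightarrow> z \<in> leaf z"
  by (simp add: leaf_def path_component_refl)

lemma leaf_subset: "leaf z \<subseteq> {y\<in>B. w y = w z}"
  unfolding leaf_def by (rule path_component_subset)

lemma leaf_eq:
  assumes "x \<in> leaf z"
  shows "leaf x = leaf z"
proof -
  have "w x = w z"
    using assms leaf_subset by blast
  then have "leaf x = path_component_set {y\<in>B. w y = w z} x"
    by (simp only: leaf_def)
  also have "\<dots> = leaf z"
    using assms unfolding leaf_def by (simp only: mem_Collect_eq path_component_eq)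
  finally show ?thesis .
qed

text \<open>This puts plaques and integral curves into leaves.\<close>

lemma connected_level_subset_leaf:
  assumes "path_connected K" "x \<in> K" "K \<subseteq> {y\<in>B. w y = w x}"
  shows "K \<subseteq> leaf x"
  unfolding leaf_def by (rule path_component_maximal[OF assms(2,1,3)])

text \<open>The plaque of \<open>x\<close> in a flow box is the image of a convex slice of the box, hence a connected piece of
  the level set, and therefore contained in the leaf of \<open>x\<close>. Conversely \<open>w\<close> is constant on leaves.\<close>

lemma foliation_leaves: "foliation B (leaf ` B)"
  unfolding foliation_def
proof (intro conjI ballI open_B)
  show "partition_on B (leaf ` B)"
  proof (rule partition_onI)
    show "\<Union>(leaf ` B) = B"
      using leaf_subset leaf_refl by blast
    show "disjnt L M" if "L \<in> leaf ` B" "M \<in> leaf ` B" "L \<noteq> M" for L M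
      using that leaf_eq unfolding disjnt_def by blast
    show "{} \<notin> leaf ` B"
      using leaf_refl by blast
  qed
  show "path_connected L" if "L \<in> leaf ` B" for L
    using that path_connected_path_component by (auto simp: leaf_def)
  fix z assume z: "z \<in> B"
  obtain V a b \<psi> where zV: "z \<in> V" and "flow_box V a b \<psi>"
    by (rule local_chart[OF z])
  note V = flow_boxD[OF this(2)]
  have plaque: "path_component_set (L \<inter> V) x = {y\<in>V. \<phi> y $ 2 = \<phi> x $ 2}" if L: "L \<in> leaf ` B" and x: "x \<in> L \<inter> V" for L x
  proof
    have Lx: "L = leaf x"
      using L x leaf_eq by blast
    have "path_component_set (L \<inter> V) x \<subseteq> L \<inter> V"
      by (rule path_component_subset)
    then show "path_component_set (L \<inter> V) x \<subseteq> {y\<in>V. \<phi> y $ 2 = \<phi> x $ 2}"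
      using leaf_subset[of x] unfolding Lx \<phi>_def by auto
    let ?K = "{y\<in>V. \<phi> y $ 2 = \<phi> x $ 2}"
    have K: "?K = \<psi> ` (box a b \<inter> {q. axis 2 1 \<bullet> q = \<phi> x $ 2})" (is "_ = _ ` ?Q")
    proof (intro equalityI subsetI)
      fix y assume "y \<in> ?K"
      then have "\<phi> y \<in> ?Q" "y = \<psi> (\<phi> y)"
        using V(4,5) by (auto simp: inner_axis')
      then show "y \<in> \<psi> ` ?Q"
        by blast
    next
      fix y assume "y \<in> \<psi> ` ?Q"
      then show "y \<in> ?K"
        using V(6,7) by (auto simp: inner_axis')
    qed
    have "path_connected ?K"
      unfolding K using V(8)
      by (intro path_connected_continuous_image convex_imp_path_connected convex_Int convex_box convex_hyperplane
          continuous_on_subset[OF smooth_on_continuous[OF V(8)] Int_lower1])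
    moreover have xK: "x \<in> ?K"
      using x by simp
    moreover have "?K \<subseteq> L"
      unfolding Lx
    proof (rule connected_level_subset_leaf[OF calculation])
      show "?K \<subseteq> {y\<in>B. w y = w x}"
        using V(2) by (auto simp: \<phi>_def)
    qed
    ultimately show "?K \<subseteq> path_component_set (L \<inter> V) x"
      by (intro path_component_maximal) auto
  qed
  show "\<exists>V (\<phi> :: real^2 \<Rightarrow> real^2) a b. z \<in> V \<and> V \<subseteq> B \<and> diffeo_on V \<phi> \<and> \<phi> ` V = box a b \<and>
        (\<forall>L\<in>leaf ` B. \<forall>x\<in>L \<inter> V. path_component_set (L \<inter> V) x = {y\<in>V. \<phi> y $ 2 = \<phi> x $ 2})"
    by (intro exI[of _ V] exI[of _ \<phi>] exI[of _ a] exI[of _ b] conjI ballI zV V(2-4) plaque)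
qed

text \<open>In a flow box, \<open>\<psi>(\<phi>(z) + t e\<^sub>1)\<close> is such a curve: its velocity is the first partial derivative of \<open>\<psi>\<close>.\<close>

lemma integral_curve:
  assumes z: "z \<in> B"
  obtains \<gamma> e where "e > 0" "smooth_on {-e<..<e} \<gamma>" "\<gamma> ` {-e<..<e} \<subseteq> leaf z" "\<gamma> 0 = z"
    "\<forall>t\<in>{-e<..<e}. velocity \<gamma> t = X (\<gamma> t)"
proof -
  obtain V a b \<psi> where zV: "z \<in> V" and "flow_box V a b \<psi>"
    by (rule local_chart[OF z])
  note V = flow_boxD[OF this(2)]
  have "\<phi> z \<in> box a b"
    using zV V(4) by blast
  then obtain e where e: "e > 0" "ball (\<phi> z) e \<subseteq> box a b"
    using open_box open_contains_ball by blast
  define l where "l = (\<lambda>t. \<phi> z + t *\<^sub>R axis 1 1)"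
  define \<gamma> where "\<gamma> = (\<lambda>t. \<psi> (l t))"
  have l: "l t \<in> box a b" if "t \<in> {-e<..<e}" for t
  proof -
    have "dist (\<phi> z) (l t) = \<bar>t\<bar>"
      by (simp add: l_def dist_norm)
    also have "\<dots> < e"
      using that by auto
    finally show ?thesis
      using e(2) by auto
  qed
  have dl: "(l has_derivative (\<lambda>s. s *\<^sub>R axis 1 1)) (at t)" for t
    unfolding l_def by (auto intro!: derivative_eq_intros)
  have "smooth_on {-e<..<e} l"
    by (rule smooth_on_has_derivative[OF _ dl]) (auto intro: smooth_on_const)
  then have sm\<gamma>: "smooth_on {-e<..<e} \<gamma>"
    unfolding \<gamma>_def by (intro smooth_on_compose[OF _ _ V(8)]) (use l in auto)
  have vel: "velocity \<gamma> t = X (\<gamma> t)" if "t \<in> {-e<..<e}" for t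
  proof -
    have "(\<gamma> has_derivative (\<lambda>s. (s *\<^sub>R axis 1 1 :: real^2) $ 1 *\<^sub>R X (\<psi> (l t)) + (s *\<^sub>R axis 1 1 :: real^2) $ 2 *\<^sub>R Y (\<psi> (l t)))) (at t)"
      unfolding \<gamma>_def by (rule has_derivative_compose[OF dl V(9)[OF l[OF that]]])
    then have "(\<gamma> has_vector_derivative X (\<gamma> t)) (at t)"
      by (simp add: has_vector_derivative_def axis_def \<gamma>_def)
    then show ?thesis
      unfolding velocity_def by (rule vector_derivative_at)
  qed
  have \<gamma>0: "\<gamma> 0 = z"
    using zV V(5) by (simp add: \<gamma>_def l_def)
  have "\<gamma> ` {-e<..<e} \<subseteq> leaf (\<gamma> 0)"
  proof (rule connected_level_subset_leaf)
    show "path_connected (\<gamma> ` {-e<..<e})"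
      using smooth_on_continuous[OF sm\<gamma>] by (intro path_connected_continuous_image convex_imp_path_connected) auto
    have "w (\<gamma> t) = w z" if "t \<in> {-e<..<e}" for t
    proof -
      have "\<phi> (\<gamma> t) = l t"
        using V(7) l[OF that] by (simp add: \<gamma>_def)
      then have "\<phi> (\<gamma> t) $ 2 = \<phi> z $ 2"
        by (simp add: l_def axis_def)
      then show ?thesis
        by (simp add: \<phi>_def)
    qed
    moreover have "\<gamma> t \<in> B" if "t \<in> {-e<..<e}" for t
      unfolding \<gamma>_def by (rule subsetD[OF V(2) V(6)[OF l[OF that]]])
    ultimately show "\<gamma> ` {-e<..<e} \<subseteq> {y\<in>B. w y = w (\<gamma> 0)}"
      unfolding \<gamma>0 by (intro image_subsetI CollectI conjI)
    show "\<gamma> 0 \<in> \<gamma> ` {-e<..<e}"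
      using e(1) by (intro imageI) simp
  qed
  then have "\<gamma> ` {-e<..<e} \<subseteq> leaf z"
    by (simp only: \<gamma>0)
  moreover have "\<forall>t\<in>{-e<..<e}. velocity \<gamma> t = X (\<gamma> t)"
    by (intro ballI vel)
  ultimately show thesis
    by (rule that[OF e(1) sm\<gamma> _ \<gamma>0])
qed

lemma leaf_tangent_span:
  assumes "z \<in> B" "v \<in> leaf_tangent (leaf ` B) z"
  shows "v = (\<alpha> z \<bullet> v) *\<^sub>R X z"
proof -
  obtain x \<gamma> e where x: "e > 0" "smooth_on {-e<..<e} \<gamma>" "\<gamma> ` {-e<..<e} \<subseteq> leaf x" "\<gamma> 0 = z" "velocity \<gamma> 0 = v"
    using assms(2) unfolding leaf_tangent_def by auto
  have "(\<gamma> has_vector_derivative v) (at 0)"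
    using smooth_curve(1)[OF _ x(2), of 0] x(1,5) by simp
  then have "((\<lambda>t. w (\<gamma> t)) has_derivative (\<lambda>s. \<beta> z \<bullet> (s *\<^sub>R v))) (at 0)"
    unfolding has_vector_derivative_def by (rule has_derivative_compose) (use dw[OF assms(1)] x(4) in simp)
  moreover have "((\<lambda>t. w (\<gamma> t)) has_derivative (\<lambda>s. 0)) (at 0)"
  proof (rule has_derivative_transform_within_open[OF has_derivative_const[of "w x"], of "{-e<..<e}"])
    show "w x = w (\<gamma> t)" if "t \<in> {-e<..<e}" for t
      using subsetD[OF leaf_subset subsetD[OF x(3) imageI[OF that]]] by simp
  qed (use x(1) in auto)
  ultimately have "(\<lambda>s. \<beta> z \<bullet> (s *\<^sub>R v)) = (\<lambda>s. 0)"
    by (rule has_derivative_unique)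
  from fun_cong[OF this, of 1] have "\<beta> z \<bullet> v = 0"
    by simp
  then show ?thesis
    using frame_expansion[OF assms(1), of v] by simp
qed

end

section \<open>Pencils of covector fields\<close>

abbreviation coord :: "(real^2 \<Rightarrow> real^2) \<Rightarrow> 2 \<Rightarrow> real^2 \<Rightarrow> real" where
  "coord a i \<equiv> (\<lambda>z. a z $ i)"

definition curl :: "(real^2 \<Rightarrow> real^2) \<Rightarrow> real^2 \<Rightarrow> real" where
  "curl a z = partial 1 (coord a 2) z - partial 2 (coord a 1) z"

lemma smooth_on_coord: "open S \<Longrightarrow> smooth_on S a \<Longrightarrow> smooth_on S (coord a i)"
  by (rule smooth_on_linear[OF _ bounded_linear_vec_nth])

lemma smooth_on_vecI:
  fixes a :: "real^2 \<Rightarrow> real^2"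
  shows "open S \<Longrightarrow> smooth_on S (coord a 1) \<Longrightarrow> smooth_on S (coord a 2) \<Longrightarrow> smooth_on S a"
  by (simp add: smooth_on_vec_iff forall_2)

lemma smooth_on_inner:
  fixes a b :: "real^2 \<Rightarrow> real^2"
  assumes "open S" "smooth_on S a" "smooth_on S b"
  shows "smooth_on S (\<lambda>z. a z \<bullet> b z)"
  using assms by (auto simp: inner_vec_def sum_2 intro!: smooth_on_add smooth_on_mult smooth_on_coord)

lemma coord_differentiable:
  fixes a :: "real^2 \<Rightarrow> real^2"
  assumes "a differentiable (at z)"
  shows "coord a i differentiable (at z)"
  using assms bounded_linear.has_derivative[OF bounded_linear_vec_nth] unfolding differentiable_def by blast

lemma curl_scale_diff:
  fixes a c :: "real^2 \<Rightarrow> real^2"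
  assumes "f differentiable (at z)" "h differentiable (at z)" "a differentiable (at z)" "c differentiable (at z)"
  shows "curl (\<lambda>z. f z *\<^sub>R c z - h z *\<^sub>R a z) z =
    f z * curl c z + (partial 1 f z * c z $ 2 - partial 2 f z * c z $ 1)
    - (h z * curl a z + (partial 1 h z * a z $ 2 - partial 2 h z * a z $ 1))"
proof -
  note d = assms(1,2) coord_differentiable[OF assms(3)] coord_differentiable[OF assms(4)]
  show ?thesis
    by (simp add: curl_def partial_diff partial_mult d differentiable_mult) (simp add: algebra_simps)
qed

lemma curl_scale:
  fixes a :: "real^2 \<Rightarrow> real^2"
  assumes "f differentiable (at z)" "a differentiable (at z)"
  shows "curl (\<lambda>z. f z *\<^sub>R a z) z = f z * curl a z + (partial 1 f z * a z $ 2 - partial 2 f z * a z $ 1)"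
proof -
  note d = assms(1) coord_differentiable[OF assms(2)]
  show ?thesis
    by (simp add: curl_def partial_mult d) (simp add: algebra_simps)
qed

text \<open>Passes from a condition on all members of a pencil to its derivative with respect to the parameter.\<close>

lemma cubic_low_coefficients:
  fixes x0 x1 x2 x3 :: real
  assumes "\<And>r. x0 + x1 * r + x2 * r ^ 2 + x3 * r ^ 3 = 0"
  shows "x0 = 0" "x1 = 0"
proof -
  show x0: "x0 = 0"
    using assms[of 0] by simp
  have "x1 + x2 + x3 = 0" "- x1 + x2 - x3 = 0" "2 * x1 + 4 * x2 + 8 * x3 = 0"
    using assms[of 1] assms[of "-1"] assms[of 2] x0 by (simp_all add: power2_eq_square power3_eq_cube)
  then show "x1 = 0"
    by linarith
qed

context metric_domain
begin

definition sqnorm :: "(real^2 \<Rightarrow> real^2) \<Rightarrow> real^2 \<Rightarrow> real" where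
  "sqnorm a z = a z \<bullet> sharp z (a z)"

text \<open>Up to the factor \<open>|a|\<^sup>3\<close>, the curl of the normalized form \<open>a / |a|\<close>. It is polynomial in \<open>a\<close> and its first
  derivatives.\<close>

definition curl_defect :: "(real^2 \<Rightarrow> real^2) \<Rightarrow> real^2 \<Rightarrow> real" where
  "curl_defect a z = sqnorm a z * curl a z
     - (partial 1 (sqnorm a) z * a z $ 2 - partial 2 (sqnorm a) z * a z $ 1) / 2"

lemma sharp_eq_powr:
  assumes "z \<in> W"
  shows "sharp z p = gdet z powr -1 *\<^sub>R
    vector [g z $ 2 $ 2 * p $ 1 - g z $ 1 $ 2 * p $ 2, g z $ 1 $ 1 * p $ 2 - g z $ 1 $ 2 * p $ 1]"
  using gdet_pos[OF assms] by (simp add: sharp_eq[OF assms] vec_eq_iff forall_2 powr_minus field_simps)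

lemma smooth_sharp:
  assumes "smooth_on W a"
  shows "smooth_on W (\<lambda>z. sharp z (a z))"
proof -
  have a: "smooth_on W (coord a i)" for i
    by (rule smooth_on_coord[OF open_W assms])
  have "smooth_on W (\<lambda>z. gdet z powr -1)"
    by (rule smooth_on_powr[OF open_W _ gdet_pos])
      (unfold gdet_def, auto intro!: smooth_on_diff smooth_on_mult open_W smooth_metric)
  then have "smooth_on W (\<lambda>z. gdet z powr -1 *\<^sub>R
    (vector [g z $ 2 $ 2 * a z $ 1 - g z $ 1 $ 2 * a z $ 2, g z $ 1 $ 1 * a z $ 2 - g z $ 1 $ 2 * a z $ 1] :: real^2))"
    by (rule smooth_on_scaleR[OF open_W])
      (auto intro!: smooth_on_vecI smooth_on_diff smooth_on_mult open_W smooth_metric a)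
  then show ?thesis
    by (rule smooth_on_cong[OF open_W, rotated]) (simp add: sharp_eq_powr)
qed

lemma sharp_sym: "z \<in> W \<Longrightarrow> p \<bullet> sharp z q = q \<bullet> sharp z p"
  by (simp add: sharp_eq_powr inner_vec_def sum_2 algebra_simps add_divide_distrib diff_divide_distrib)

lemma sharp_pos:
  assumes "z \<in> W" "p \<noteq> 0"
  shows "p \<bullet> sharp z p > 0"
proof -
  have "sharp z p \<noteq> 0"
    using flat_sharp[OF assms(1), of p] assms(2) by auto
  from metric_pos[OF assms(1) this] show ?thesis
    by (simp add: flat_sharp[OF assms(1)] inner_commute)
qed

lemma wedge_sharp: "z \<in> W \<Longrightarrow> wedge p q = gdet z * wedge (sharp z p) (sharp z q)"
  using wedge_flat[of z "sharp z p" "sharp z q"] by (simp add: flat_sharp)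

lemma smooth_sqnorm: "smooth_on W a \<Longrightarrow> smooth_on W (sqnorm a)"
  unfolding sqnorm_def[abs_def] by (intro smooth_on_inner open_W smooth_sharp)

text \<open>The squared length of \<open>a\<close> is twice the Hamiltonian on the graph of \<open>a\<close>, so the chain rule applies.\<close>

lemma partial_sqnorm:
  assumes z: "z \<in> W" and a: "a differentiable (at z)"
  defines "v \<equiv> sharp z (a z)"
  shows "partial i (sqnorm a) z = 2 * (partial i (coord a 1) z * v $ 1 + partial i (coord a 2) z * v $ 2) - dmetric g i z v"
proof -
  have "(\<lambda>x. 2 * geodesic_hamiltonian g (x, a x)) = sqnorm a"
    by (simp add: fun_eq_iff geodesic_hamiltonian_def sqnorm_def)
  moreover have "((\<lambda>x. (x, a x)) has_derivative (\<lambda>h. (h, vector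
    [partial 1 (coord a 1) z * h $ 1 + partial 2 (coord a 1) z * h $ 2,
     partial 1 (coord a 2) z * h $ 1 + partial 2 (coord a 2) z * h $ 2]))) (at z)"
    by (intro has_derivative_Pair has_derivative_ident has_derivative_components a)
  from has_derivative_mult_right[OF has_derivative_compose[OF this has_derivative_hamiltonian[OF z]], of 2]
  have "((\<lambda>x. 2 * geodesic_hamiltonian g (x, a x)) has_derivative (\<lambda>h. 2 * (vector
    [partial 1 (coord a 1) z * h $ 1 + partial 2 (coord a 1) z * h $ 2,
     partial 1 (coord a 2) z * h $ 1 + partial 2 (coord a 2) z * h $ 2] \<bullet> v
     - (dmetric g 1 z v * h $ 1 + dmetric g 2 z v * h $ 2) / 2))) (at z)"
    by (simp add: v_def)
  ultimately have "(sqnorm a has_derivative (\<lambda>h. 2 * (vector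
    [partial 1 (coord a 1) z * h $ 1 + partial 2 (coord a 1) z * h $ 2,
     partial 1 (coord a 2) z * h $ 1 + partial 2 (coord a 2) z * h $ 2] \<bullet> v
     - (dmetric g 1 z v * h $ 1 + dmetric g 2 z v * h $ 2) / 2))) (at z)"
    by simp
  from partialI[OF this, of i] show ?thesis
    using exhaust_2[of i] by (auto simp: axis_def inner_vec_def sum_2 algebra_simps)
qed

text \<open>The linear function with coefficients \<open>(a\<^sub>2, - a\<^sub>1)\<close> has the kernel spanned by \<open>a\<close>. Its bracket with \<open>H\<close>
  measures whether the Hamiltonian flow is tangent to the graph of the line field of \<open>a\<close>, and for
  line fields in dimension two this is the closedness of the normalized form.\<close>

lemma lin_bracket_curl_defect:
  assumes z: "z \<in> W" and a: "a differentiable (at z)"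
  shows "lin_bracket g (\<lambda>z. a z $ 2) (\<lambda>z. - a z $ 1) z (sharp z (a z)) = curl_defect a z"
proof -
  define v where "v = sharp z (a z)"
  have "partial i (\<lambda>z. - a z $ 1) z = - partial i (coord a 1) z" for i
    by (rule partial_minus[OF coord_differentiable[OF a]])
  then show ?thesis
    unfolding lin_bracket_def curl_defect_def curl_def partial_sqnorm[OF z a] sqnorm_def v_def[symmetric]
    by (simp add: flat_sharp[OF z, of "a z", folded v_def] sum_2 inner_vec_def algebra_simps add_divide_distrib diff_divide_distrib)
qed

text \<open>The covector \<open>(- B, A) + r (- E, C)\<close> spans the kernel of \<open>N + r M\<close>. On it \<open>M\<close> equals \<open>AE - BC\<close>, which
  is nonzero, so the Poisson condition may be evaluated there and gives \<open>{N + r M, H} = 0\<close>.\<close>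

lemma integral_pencil:
  assumes frac: "fractional_linear_integral W g A B C E" and z: "z \<in> W"
  shows "curl_defect (\<lambda>z. vector [- B z, A z] + r *\<^sub>R vector [- E z, C z]) z = 0"
proof -
  have sm: "smooth_on W A" "smooth_on W B" "smooth_on W C" "smooth_on W E"
    and det: "A z * E z - B z * C z \<noteq> 0"
    and pb: "\<And>p. C z * p $ 1 + E z * p $ 2 \<noteq> 0 \<Longrightarrow>
        poisson (fractional_linear A B C E) (geodesic_hamiltonian g) (z, p) = 0"
    using frac z by (auto simp: fractional_linear_integral_def)
  note d = sm[THEN smooth_on_differentiable, OF z]
  define a :: "real^2 \<Rightarrow> real^2" where "a = (\<lambda>z. vector [- B z, A z] + r *\<^sub>R vector [- E z, C z])"
  define v where "v = sharp z (a z)"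
  have M: "C z * a z $ 1 + E z * a z $ 2 = A z * E z - B z * C z"
    and N: "A z * a z $ 1 + B z * a z $ 2 = - r * (A z * E z - B z * C z)"
    by (simp_all add: a_def algebra_simps)
  have "lin_bracket g A B z v * (C z * a z $ 1 + E z * a z $ 2)
      - (A z * a z $ 1 + B z * a z $ 2) * lin_bracket g C E z v = 0"
    using poisson_fractional_linear[OF z d, of "a z"] pb[of "a z"] M det by (simp add: v_def)
  then have "(A z * E z - B z * C z) * (lin_bracket g A B z v + r * lin_bracket g C E z v) = 0"
    unfolding M N by (simp add: algebra_simps)
  then have "lin_bracket g A B z v + r * lin_bracket g C E z v = 0"
    using det by simp
  moreover have "lin_bracket g (\<lambda>z. A z + r * C z) (\<lambda>z. B z + r * E z) z v = lin_bracket g A B z v + r * lin_bracket g C E z v"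
    by (simp add: lin_bracket_def partial_add partial_mult partial_const d differentiable_mult sum_2 algebra_simps add_divide_distrib)
  moreover have "lin_bracket g (\<lambda>z. a z $ 2) (\<lambda>z. - a z $ 1) z v = curl_defect a z"
    unfolding v_def
  proof (rule lin_bracket_curl_defect[OF z])
    have "smooth_on W a"
      unfolding a_def by (rule smooth_on_vecI[OF open_W]) (auto intro!: smooth_on_diff smooth_on_add smooth_on_minus smooth_on_mult smooth_on_const sm open_W)
    then show "a differentiable (at z)"
      using smooth_on_differentiable z by blast
  qed
  ultimately show ?thesis
    by (simp add: a_def add.commute)
qed

lemma sqnorm_pos: "z \<in> W \<Longrightarrow> a z \<noteq> 0 \<Longrightarrow> sqnorm a z > 0"
  by (simp add: sqnorm_def sharp_pos)

lemma curl_normalized: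
  assumes a: "smooth_on W a" and z: "z \<in> W" and "a z \<noteq> 0" and "curl_defect a z = 0"
  shows "curl (\<lambda>z. sqnorm a z powr (- 1 / 2) *\<^sub>R a z) z = 0"
proof -
  have q: "sqnorm a z > 0"
    by (rule sqnorm_pos) fact+
  have dq: "sqnorm a differentiable (at z)"
    by (rule smooth_on_differentiable[OF smooth_sqnorm[OF a] z])
  have df: "(\<lambda>z. sqnorm a z powr (- 1 / 2)) differentiable (at z)"
    by (rule differentiable_powr_const[OF dq q])
  define m where "m = sqnorm a z powr (- 3 / 2)"
  have pw: "sqnorm a z powr (- 1 / 2) = sqnorm a z * m"
    using q powr_add[of "sqnorm a z" 1 "- 3 / 2"] by (simp add: m_def)
  have pp: "partial i (\<lambda>z. sqnorm a z powr (- 1 / 2)) z = - (1 / 2) * m * partial i (sqnorm a) z" for i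
    by (simp add: partial_powr[OF dq q] m_def)
  have "curl (\<lambda>z. sqnorm a z powr (- 1 / 2) *\<^sub>R a z) z = m * curl_defect a z"
    unfolding curl_scale[OF df smooth_on_differentiable[OF a z]] pp pw
    by (simp add: curl_defect_def algebra_simps diff_divide_distrib)
  then show ?thesis
    using assms(4) by simp
qed

text \<open>Half of the derivative of \<open>sqnorm (a + r c)\<close> with respect to \<open>r\<close> at \<open>0\<close>.\<close>

definition mixed :: "(real^2 \<Rightarrow> real^2) \<Rightarrow> (real^2 \<Rightarrow> real^2) \<Rightarrow> real^2 \<Rightarrow> real" where
  "mixed a c z = a z \<bullet> sharp z (c z)"

text \<open>The derivative of \<open>curl_defect (a + r c)\<close> with respect to \<open>r\<close> at \<open>0\<close>.\<close>

definition curl_defect_deriv :: "(real^2 \<Rightarrow> real^2) \<Rightarrow> (real^2 \<Rightarrow> real^2) \<Rightarrow> real^2 \<Rightarrow> real" where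
  "curl_defect_deriv a c z = sqnorm a z * curl c z + 2 * mixed a c z * curl a z
     - (partial 1 (sqnorm a) z * c z $ 2 - partial 2 (sqnorm a) z * c z $ 1) / 2
     - (partial 1 (mixed a c) z * a z $ 2 - partial 2 (mixed a c) z * a z $ 1)"

lemma smooth_mixed: "smooth_on W a \<Longrightarrow> smooth_on W c \<Longrightarrow> smooth_on W (mixed a c)"
  unfolding mixed_def[abs_def] by (intro smooth_on_inner open_W smooth_sharp)

lemma curl_defect_pencil:
  assumes a: "smooth_on W a" and c: "smooth_on W c" and z: "z \<in> W"
  shows "\<exists>x2 x3. \<forall>r. curl_defect (\<lambda>z. a z + r *\<^sub>R c z) z =
    curl_defect a z + curl_defect_deriv a c z * r + x2 * r ^ 2 + x3 * r ^ 3"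
proof -
  note da = smooth_on_differentiable[OF a z] and dc = smooth_on_differentiable[OF c z]
  note d = da[THEN coord_differentiable] dc[THEN coord_differentiable]
    smooth_sqnorm[OF a, THEN smooth_on_differentiable, OF z]
    smooth_sqnorm[OF c, THEN smooth_on_differentiable, OF z]
    smooth_mixed[OF a c, THEN smooth_on_differentiable, OF z]
  have q: "sqnorm (\<lambda>z. a z + r *\<^sub>R c z) z = sqnorm a z + 2 * r * mixed a c z + r ^ 2 * sqnorm c z" if "z \<in> W" for r z
    using sharp_sym[OF that, of "c z" "a z"]
    by (simp add: sqnorm_def mixed_def matrix_vector_right_distrib matrix_vector_mult_scaleR inner_add_left
        inner_add_right algebra_simps power2_eq_square)
  have pq: "partial i (sqnorm (\<lambda>z. a z + r *\<^sub>R c z)) z =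
      partial i (sqnorm a) z + 2 * r * partial i (mixed a c) z + r ^ 2 * partial i (sqnorm c) z" for i r
  proof -
    have "partial i (sqnorm (\<lambda>z. a z + r *\<^sub>R c z)) z =
        partial i (\<lambda>z. sqnorm a z + 2 * r * mixed a c z + r ^ 2 * sqnorm c z) z"
      by (rule partial_cong[OF open_W z]) (auto simp: q d)
    then show ?thesis
      by (simp add: partial_add partial_mult partial_const d)
  qed
  have cu: "curl (\<lambda>z. a z + r *\<^sub>R c z) z = curl a z + r * curl c z" for r
    by (simp add: curl_def partial_add partial_mult partial_const d algebra_simps)
  show ?thesis
  proof (intro exI allI)
    show "curl_defect (\<lambda>z. a z + r *\<^sub>R c z) z = curl_defect a z + curl_defect_deriv a c z * r
      + (2 * mixed a c z * curl c z + sqnorm c z * curl a z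
         - (partial 1 (mixed a c) z * c z $ 2 - partial 2 (mixed a c) z * c z $ 1)
         - (partial 1 (sqnorm c) z * a z $ 2 - partial 2 (sqnorm c) z * a z $ 1) / 2) * r ^ 2
      + (sqnorm c z * curl c z
         - (partial 1 (sqnorm c) z * c z $ 2 - partial 2 (sqnorm c) z * c z $ 1) / 2) * r ^ 3" for r
      unfolding curl_defect_def[of "\<lambda>z. a z + r *\<^sub>R c z"] pq cu q[OF z]
      by (simp add: curl_defect_def curl_defect_deriv_def field_simps power2_eq_square power3_eq_cube)
  qed
qed

text \<open>The form is the derivative of \<open>(a + r c) / |a + r c|\<close> with respect to \<open>r\<close> at \<open>0\<close>. Since \<open>curl\<close> commutes with
  \<open>\<partial>/\<partial>r\<close>, its curl is the derivative of \<open>curl_defect (a + r c) / |a + r c|\<^sup>3\<close>, computed here in closed form.\<close>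

lemma curl_normalized_deriv:
  assumes a: "smooth_on W a" and c: "smooth_on W c" and z: "z \<in> W" and "a z \<noteq> 0"
    and defect: "curl_defect a z = 0" and deriv: "curl_defect_deriv a c z = 0"
  shows "curl (\<lambda>z. sqnorm a z powr (- 1 / 2) *\<^sub>R c z - (mixed a c z * sqnorm a z powr (- 3 / 2)) *\<^sub>R a z) z = 0"
proof -
  define q where "q = sqnorm a z"
  have q: "q > 0"
    unfolding q_def by (rule sqnorm_pos) fact+
  have dq: "sqnorm a differentiable (at z)"
    by (rule smooth_on_differentiable[OF smooth_sqnorm[OF a] z])
  have ds: "mixed a c differentiable (at z)"
    by (rule smooth_on_differentiable[OF smooth_mixed[OF a c] z])
  have df: "(\<lambda>z. sqnorm a z powr s) differentiable (at z)" for s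
    using dq q unfolding q_def by (rule differentiable_powr_const)
  define m where "m = q powr (- 5 / 2)"
  have pw: "q powr (- 1 / 2) = q * q * m" "q powr (- 3 / 2) = q * m"
    using q powr_add[of q 2 "- 5 / 2"] powr_add[of q 1 "- 5 / 2"] by (simp_all add: m_def powr_numeral power2_eq_square)
  have pp: "partial i (\<lambda>z. sqnorm a z powr (- 1 / 2)) z = - (1 / 2) * (q * m) * partial i (sqnorm a) z"
    "partial i (\<lambda>z. sqnorm a z powr (- 3 / 2)) z = - (3 / 2) * m * partial i (sqnorm a) z" for i
    using pw q by (simp_all add: partial_powr[OF dq] q_def[symmetric] m_def)
  let ?D = "partial 1 (sqnorm a) z * a z $ 2 - partial 2 (sqnorm a) z * a z $ 1"
  have D: "?D = 2 * q * curl a z"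
    using defect by (simp add: curl_defect_def q_def)
  have "curl (\<lambda>z. sqnorm a z powr (- 1 / 2) *\<^sub>R c z - (mixed a c z * sqnorm a z powr (- 3 / 2)) *\<^sub>R a z) z
      = q * m * (q * curl c z - (partial 1 (sqnorm a) z * c z $ 2 - partial 2 (sqnorm a) z * c z $ 1) / 2
          - mixed a c z * curl a z - (partial 1 (mixed a c) z * a z $ 2 - partial 2 (mixed a c) z * a z $ 1))
        + 3 / 2 * m * mixed a c z * ?D"
    unfolding curl_scale_diff[OF df differentiable_mult[OF ds df] smooth_on_differentiable[OF a z] smooth_on_differentiable[OF c z]]
      partial_mult[OF ds df] pp q_def[symmetric] pw
    by (simp add: algebra_simps diff_divide_distrib)
  also have "\<dots> = q * m * curl_defect_deriv a c z"
    unfolding D by (simp add: curl_defect_deriv_def q_def algebra_simps)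
  finally show ?thesis
    using deriv by simp
qed

text \<open>The eikonal argument: for \<open>X\<close> dual to \<open>\<alpha>\<close>, closedness turns \<open>X\<^sup>i \<partial>\<^sub>i \<alpha>\<^sub>l\<close> into \<open>X\<^sup>i \<partial>\<^sub>l \<alpha>\<^sub>i\<close>, and differentiating
  \<open>|\<alpha>| = 1\<close> identifies the latter with half of \<open>(\<partial>\<^sub>l g)(X, X)\<close>. This is the geodesic equation with lowered
  index for the curves with velocity \<open>X\<close>.\<close>

lemma unit_closed_geodesic:
  assumes \<alpha>: "smooth_on W \<alpha>" and unit: "\<And>z. z \<in> W \<Longrightarrow> \<alpha> z \<bullet> sharp z (\<alpha> z) = 1"
    and closed: "\<And>z. z \<in> W \<Longrightarrow> curl \<alpha> z = 0"
    and T: "open T" "smooth_on T \<gamma>" "\<gamma> ` T \<subseteq> W" "\<And>t. t \<in> T \<Longrightarrow> velocity \<gamma> t = sharp (\<gamma> t) (\<alpha> (\<gamma> t))"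
  shows "geodesic_on T g \<gamma>"
  unfolding geodesic_on_def
proof (intro conjI ballI allI T(2))
  define X where "X = (\<lambda>z. sharp z (\<alpha> z))"
  fix t assume t: "t \<in> T"
  define z where "z = \<gamma> t"
  have z: "z \<in> W"
    using T(3) t by (auto simp: z_def)
  have vt: "velocity \<gamma> t = X z"
    using T(4)[OF t] by (simp add: X_def z_def)
  show "velocity \<gamma> t \<noteq> 0"
    using unit[OF z] by (auto simp: vt X_def)
  define w where "w = velocity (velocity \<gamma>) t"
  have flatX: "g u *v X u = \<alpha> u" if "u \<in> W" for u
    by (simp only: X_def flat_sharp[OF that])
  have smX: "smooth_on W X"
    unfolding X_def by (rule smooth_sharp[OF \<alpha>])
  note dX = smooth_on_differentiable[OF smooth_on_coord[OF open_W smX] z] and d\<alpha> = smooth_on_differentiable[OF smooth_on_coord[OF open_W \<alpha>] z]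
  note dg = diff_metric[OF z]
  have d1: "(\<gamma> has_vector_derivative X z) (at t)"
    using smooth_curve(1)[OF T(1,2) t] by (simp add: vt)
  have w: "w $ k = partial 1 (coord X k) z * X z $ 1 + partial 2 (coord X k) z * X z $ 2" for k
  proof -
    have "(velocity \<gamma> has_vector_derivative w) (at t)"
      unfolding w_def by (rule smooth_curve(1)[OF T(1) smooth_curve(2)[OF T(1,2)] t])
    from bounded_linear.has_vector_derivative[OF bounded_linear_vec_nth this, of k]
    have "((\<lambda>t. velocity \<gamma> t $ k) has_real_derivative w $ k) (at t)"
      by (simp add: has_real_derivative_iff_has_vector_derivative)
    then have "((\<lambda>t. X (\<gamma> t) $ k) has_real_derivative w $ k) (at t)"
      by (rule has_field_derivative_transform_within_open[OF _ T(1) t]) (simp add: T(4) X_def)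
    moreover have "((\<lambda>t. X (\<gamma> t) $ k) has_real_derivative
        partial 1 (coord X k) z * X z $ 1 + partial 2 (coord X k) z * X z $ 2) (at t)"
      using has_derivative_along_curve[OF d1, of "coord X k"] dX by (simp add: z_def)
    ultimately show ?thesis
      by (rule DERIV_unique)
  qed
  have lower: "partial i (coord \<alpha> l) z = (g z $ l $ 1 * partial i (coord X 1) z + partial i (\<lambda>u. g u $ l $ 1) z * X z $ 1)
      + (g z $ l $ 2 * partial i (coord X 2) z + partial i (\<lambda>u. g u $ l $ 2) z * X z $ 2)" for i l
  proof -
    have "partial i (coord \<alpha> l) z = partial i (\<lambda>u. g u $ l $ 1 * X u $ 1 + g u $ l $ 2 * X u $ 2) z"
    proof (rule partial_cong[OF open_W z])
      show "g u $ l $ 1 * X u $ 1 + g u $ l $ 2 * X u $ 2 = \<alpha> u $ l" if "u \<in> W" for u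
        using mv2[of "g u" "X u" l] flatX[OF that] by simp
    qed (intro differentiable_add differentiable_mult dX dg)
    also have "\<dots> = (g z $ l $ 1 * partial i (coord X 1) z + partial i (\<lambda>u. g u $ l $ 1) z * X z $ 1)
      + (g z $ l $ 2 * partial i (coord X 2) z + partial i (\<lambda>u. g u $ l $ 2) z * X z $ 2)"
      by (subst partial_add, (intro differentiable_mult dX dg)+) (simp only: partial_mult[OF dg dX])
    finally show ?thesis .
  qed
  have \<alpha>z: "\<alpha> z $ 1 = g z $ 1 $ 1 * X z $ 1 + g z $ 1 $ 2 * X z $ 2" "\<alpha> z $ 2 = g z $ 1 $ 2 * X z $ 1 + g z $ 2 $ 2 * X z $ 2"
    using mv2[of "g z" "X z" 1] mv2[of "g z" "X z" 2] flatX[OF z] metric_sym[OF z] by simp_all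
  have norm: "(\<alpha> z $ 1 * partial l (coord X 1) z + partial l (coord \<alpha> 1) z * X z $ 1)
      + (\<alpha> z $ 2 * partial l (coord X 2) z + partial l (coord \<alpha> 2) z * X z $ 2) = 0" for l
  proof -
    have "partial l (\<lambda>u. \<alpha> u $ 1 * X u $ 1 + \<alpha> u $ 2 * X u $ 2) z = partial l (\<lambda>u. 1) z"
      by (rule partial_cong[OF open_W z]) (use unit in \<open>auto simp: X_def inner_vec_def sum_2\<close>)
    also have "\<dots> = 0"
      by (rule partial_const)
    also have "partial l (\<lambda>u. \<alpha> u $ 1 * X u $ 1 + \<alpha> u $ 2 * X u $ 2) z =
        (\<alpha> z $ 1 * partial l (coord X 1) z + partial l (coord \<alpha> 1) z * X z $ 1)
      + (\<alpha> z $ 2 * partial l (coord X 2) z + partial l (coord \<alpha> 2) z * X z $ 2)"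
      by (subst partial_add, (intro differentiable_mult dX d\<alpha>)+) (simp only: partial_mult[OF d\<alpha> dX])
    finally show ?thesis .
  qed
  \<comment> \<open>Here the unit length of \<open>\<alpha>\<close> enters, and below its closedness.\<close>
  have half: "X z $ 1 * partial l (coord \<alpha> 1) z + X z $ 2 * partial l (coord \<alpha> 2) z = dmetric g l z (X z) / 2" for l
    using norm[of l] unfolding lower[of l] \<alpha>z dmetric_eq[OF z] partial_metric_sym[OF z] metric_sym[OF z]
    by (simp add: algebra_simps power2_eq_square)
  have cl: "partial 1 (coord \<alpha> 2) z = partial 2 (coord \<alpha> 1) z"
    using closed[OF z] by (simp add: curl_def)
  have "(g z *v w) $ l + (\<Sum>i\<in>UNIV. \<Sum>j\<in>UNIV. partial i (\<lambda>u. g u $ j $ l) z * X z $ i * X z $ j) = dmetric g l z (X z) / 2" for l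
  proof -
    have "(g z *v w) $ l + (\<Sum>i\<in>UNIV. \<Sum>j\<in>UNIV. partial i (\<lambda>u. g u $ j $ l) z * X z $ i * X z $ j)
        = X z $ 1 * partial 1 (coord \<alpha> l) z + X z $ 2 * partial 2 (coord \<alpha> l) z"
      using exhaust_2[of l] by (auto simp: lower mv2 w sum_2 partial_metric_sym[OF z] algebra_simps)
    also have "\<dots> = X z $ 1 * partial l (coord \<alpha> 1) z + X z $ 2 * partial l (coord \<alpha> 2) z"
      using exhaust_2[of l] by (auto simp: cl)
    finally show ?thesis
      by (simp only: half)
  qed
  then have "\<forall>k. w $ k + (\<Sum>i\<in>UNIV. \<Sum>j\<in>UNIV. christoffel g z k i j * X z $ i * X z $ j) = 0"
    using geodesic_equation_lowered[OF z, of w "X z"] by simp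
  then show "velocity (velocity \<gamma>) t $ k + (\<Sum>i\<in>UNIV. \<Sum>j\<in>UNIV. christoffel g (\<gamma> t) k i j * velocity \<gamma> t $ i * velocity \<gamma> t $ j) = 0" for k
    by (simp add: vt w_def z_def)
qed

end

section \<open>Integrals and geodesic Nakai webs\<close>

lemma zero_in_leaf_tangent:
  assumes "foliation W \<F>" "z \<in> W"
  shows "0 \<in> leaf_tangent \<F> z"
proof -
  obtain L where "L \<in> \<F>" "z \<in> L"
    using assms by (auto simp: foliation_def partition_on_def)
  moreover have "velocity (\<lambda>t. z) 0 = 0"
    by (simp add: velocity_def)
  ultimately show ?thesis
    unfolding leaf_tangent_def
    by (intro CollectI bexI[of _ L] exI[of _ "\<lambda>t. z"] exI[of _ 1]) (auto simp: smooth_on_const)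
qed

text \<open>The forms \<open>\<alpha> = a / |a|\<close> and \<open>\<beta>\<close>, its derivative in the direction of \<open>c\<close>, are closed and mutually
  orthogonal, so their duals, suitably scaled, form the dual frame. Convexity makes the Poincare lemma
  available on all of \<open>W\<close>, so that foliations for different members of a pencil live on the same set.\<close>

lemma (in metric_domain) pencil_foliation:
  assumes "convex W" "z\<^sub>0 \<in> W" and a: "smooth_on W a" and c: "smooth_on W c"
    and indep: "\<And>z. z \<in> W \<Longrightarrow> wedge (a z) (c z) \<noteq> 0"
    and defect: "\<And>z r. z \<in> W \<Longrightarrow> curl_defect (\<lambda>z. a z + r *\<^sub>R c z) z = 0"
  shows "\<exists>\<F>. foliation W \<F> \<and> (\<forall>L\<in>\<F>. geodesic_leaf g L) \<and>
    (\<forall>z\<in>W. \<forall>v\<in>leaf_tangent \<F> z. \<exists>k. v = k *\<^sub>R sharp z (a z))"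
proof -
  define q where "q = sqnorm a"
  define \<alpha> where "\<alpha> = (\<lambda>z. q z powr (- 1 / 2) *\<^sub>R a z)"
  define \<beta> where "\<beta> = (\<lambda>z. q z powr (- 1 / 2) *\<^sub>R c z - (mixed a c z * q z powr (- 3 / 2)) *\<^sub>R a z)"
  define X where "X = (\<lambda>z. sharp z (\<alpha> z))"
  define Y where "Y = (\<lambda>z. sqnorm \<beta> z powr (- 1) *\<^sub>R sharp z (\<beta> z))"
  have a0: "a z \<noteq> 0" if "z \<in> W" for z
    using indep[OF that] by (auto simp: wedge_def)
  have q: "q z > 0" if "z \<in> W" for z
    unfolding q_def by (rule sqnorm_pos[where a = a, OF that a0[OF that]])
  have smq: "smooth_on W (\<lambda>z. q z powr s)" for s
    by (rule smooth_on_powr[OF open_W _ q]) (simp add: q_def smooth_sqnorm[OF a])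
  have sm\<alpha>: "smooth_on W \<alpha>"
    unfolding \<alpha>_def by (intro smooth_on_scaleR open_W smq a)
  have sm\<beta>: "smooth_on W \<beta>"
    unfolding \<beta>_def by (intro smooth_on_diff smooth_on_scaleR smooth_on_mult open_W smq a c smooth_mixed)
  have \<beta>0: "\<beta> z \<noteq> 0" if z: "z \<in> W" for z
  proof
    assume "\<beta> z = 0"
    moreover have "wedge (a z) (\<beta> z) = q z powr (- 1 / 2) * wedge (a z) (c z)"
      by (simp add: \<beta>_def wedge_def algebra_simps)
    ultimately show False
      using indep[OF z] q[OF z] by (simp add: wedge_def)
  qed
  have \<beta>pos: "sqnorm \<beta> z > 0" if "z \<in> W" for z
    by (rule sqnorm_pos[where a = \<beta>, OF that \<beta>0[OF that]])
  have smX: "smooth_on W X" and smY: "smooth_on W Y"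
    unfolding X_def Y_def
    by (intro smooth_sharp smooth_on_scaleR open_W smooth_on_powr smooth_sqnorm sm\<alpha> sm\<beta> \<beta>pos; assumption)+
  have half: "q z powr (- 1 / 2) * q z powr (- 1 / 2) * q z = 1"
    "q z powr (- 3 / 2) * q z = q z powr (- 1 / 2)" if "z \<in> W" for z
  proof -
    have "q z powr (- 1 / 2) * q z powr (- 1 / 2) = inverse (q z)"
      using q[OF that] powr_add[of "q z" "- 1 / 2" "- 1 / 2"] powr_minus[of "q z" 1] by simp
    then show "q z powr (- 1 / 2) * q z powr (- 1 / 2) * q z = 1"
      using q[OF that] by simp
    show "q z powr (- 3 / 2) * q z = q z powr (- 1 / 2)"
      using q[OF that] powr_add[of "q z" "- 3 / 2" 1] by simp
  qed
  have unit: "\<alpha> z \<bullet> sharp z (\<alpha> z) = 1" if "z \<in> W" for z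
    using half(1)[OF that] by (simp add: \<alpha>_def matrix_vector_mult_scaleR q_def sqnorm_def mult_ac)
  have orth: "\<beta> z \<bullet> sharp z (\<alpha> z) = 0" if z: "z \<in> W" for z
  proof -
    have "\<beta> z \<bullet> sharp z (\<alpha> z) = q z powr (- 1 / 2) * (q z powr (- 1 / 2) * mixed a c z
        - mixed a c z * (q z powr (- 3 / 2) * q z))"
      by (simp add: \<alpha>_def \<beta>_def matrix_vector_mult_scaleR inner_diff_left sharp_sym[OF z, of "c z" "a z"]
          mixed_def q_def sqnorm_def algebra_simps)
    then show ?thesis
      unfolding half(2)[OF z] by simp
  qed
  have defects: "curl_defect a z = 0" "curl_defect_deriv a c z = 0" if z: "z \<in> W" for z
  proof -
    obtain x2 x3 where x: "\<forall>r. curl_defect (\<lambda>z. a z + r *\<^sub>R c z) z =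
        curl_defect a z + curl_defect_deriv a c z * r + x2 * r ^ 2 + x3 * r ^ 3"
      using curl_defect_pencil[OF a c z] by (elim exE) (rule that)
    have "curl_defect a z + curl_defect_deriv a c z * r + x2 * r ^ 2 + x3 * r ^ 3 = 0" for r
      using x[rule_format, of r] defect[OF z, of r] by (rule trans[OF sym])
    then show "curl_defect a z = 0" "curl_defect_deriv a c z = 0"
      by (rule cubic_low_coefficients)+
  qed
  have closed\<alpha>: "curl \<alpha> z = 0" if z: "z \<in> W" for z
    unfolding \<alpha>_def q_def by (rule curl_normalized[OF a z a0[OF z] defects(1)[OF z]])
  have closed\<beta>: "curl \<beta> z = 0" if z: "z \<in> W" for z
    unfolding \<beta>_def q_def by (rule curl_normalized_deriv[OF a c z a0[OF z] defects[OF z]])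
  have "partial 1 (coord \<alpha> 2) z = partial 2 (coord \<alpha> 1) z" if "z \<in> W" for z
    using closed\<alpha>[OF that] by (simp add: curl_def)
  then obtain u where u: "smooth_on W u" "\<forall>z\<in>W. (u has_derivative (\<lambda>v. \<alpha> z \<bullet> v)) (at z)"
    by (rule closed_form_has_potential[OF open_W assms(1,2) sm\<alpha>])
  have "partial 1 (coord \<beta> 2) z = partial 2 (coord \<beta> 1) z" if "z \<in> W" for z
    using closed\<beta>[OF that] by (simp add: curl_def)
  then obtain w where w: "smooth_on W w" "\<forall>z\<in>W. (w has_derivative (\<lambda>v. \<beta> z \<bullet> v)) (at z)"
    by (rule closed_form_has_potential[OF open_W assms(1,2) sm\<beta>])
  interpret framed_map W u w \<alpha> \<beta> X Y
  proof
    fix z assume z: "z \<in> W"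
    show "\<alpha> z \<bullet> X z = 1" "\<beta> z \<bullet> X z = 0"
      using unit[OF z] orth[OF z] by (simp_all add: X_def)
    show "\<alpha> z \<bullet> Y z = 0"
      using orth[OF z] sharp_sym[OF z, of "\<alpha> z" "\<beta> z"] by (simp add: Y_def)
    show "\<beta> z \<bullet> Y z = 1"
      using \<beta>pos[OF z] by (simp add: Y_def sqnorm_def powr_minus)
    show "(u has_derivative (\<lambda>v. \<alpha> z \<bullet> v)) (at z)" "(w has_derivative (\<lambda>v. \<beta> z \<bullet> v)) (at z)"
      using u(2) w(2) z by simp_all
  qed (fact open_W u w smX smY sm\<alpha> sm\<beta>)+
  have "geodesic_leaf g (leaf x)" for x
    unfolding geodesic_leaf_def
  proof
    fix z assume z: "z \<in> leaf x"
    then have "z \<in> W"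
      using leaf_subset by blast
    then obtain \<gamma> e where \<gamma>: "e > 0" "smooth_on {-e<..<e} \<gamma>" "\<gamma> ` {-e<..<e} \<subseteq> leaf z" "\<gamma> 0 = z"
      "\<forall>t\<in>{-e<..<e}. velocity \<gamma> t = X (\<gamma> t)"
      by (rule integral_curve)
    have "\<gamma> ` {-e<..<e} \<subseteq> W"
      using \<gamma>(3) leaf_subset[of z] by blast
    then have "geodesic_on {-e<..<e} g \<gamma>"
      using \<gamma>(5) by (intro unit_closed_geodesic[OF sm\<alpha> unit closed\<alpha> _ \<gamma>(2)]) (auto simp: X_def)
    then show "\<exists>\<gamma> e. e > 0 \<and> geodesic_on {-e<..<e} g \<gamma> \<and> \<gamma> ` {-e<..<e} \<subseteq> leaf x \<and> \<gamma> 0 = z"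
      using \<gamma>(1,3,4) unfolding leaf_eq[OF z] by blast
  qed
  moreover have "\<exists>k. v = k *\<^sub>R sharp z (a z)" if "z \<in> W" "v \<in> leaf_tangent (leaf ` W) z" for z v
  proof -
    have "v = ((\<alpha> z \<bullet> v) * q z powr (- 1 / 2)) *\<^sub>R sharp z (a z)"
      using leaf_tangent_span[OF that] by (simp add: X_def \<alpha>_def matrix_vector_mult_scaleR)
    then show ?thesis
      by blast
  qed
  ultimately show ?thesis
    using foliation_leaves by blast
qed

text \<open>The levels of a fractional-linear function form a pencil, and the four parameters, being constant,
  have a constant cross-ratio.\<close>

lemma (in metric_domain) web_of_integral:
  assumes frac: "fractional_linear_integral W g A B C E" and "convex W" "z\<^sub>0 \<in> W"
  shows "\<exists>\<F>. nakai_web W \<F> \<and> geodesic_web g \<F>"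
proof -
  define a :: "real^2 \<Rightarrow> real^2" where "a = (\<lambda>z. vector [- B z, A z])"
  define c :: "real^2 \<Rightarrow> real^2" where "c = (\<lambda>z. vector [- E z, C z])"
  \<comment> \<open>Four members of the pencil; their constant parameters \<open>1, 2, 3, 4\<close> have cross-ratio \<open>4 / 3\<close>.\<close>
  define b where "b = (\<lambda>(i::nat) z. a z + real i *\<^sub>R c z)"
  have sm: "smooth_on W A" "smooth_on W B" "smooth_on W C" "smooth_on W E"
    using frac by (auto simp: fractional_linear_integral_def)
  have smc: "smooth_on W c" and sma: "smooth_on W a"
    unfolding a_def c_def by (rule smooth_on_vecI[OF open_W]; simp add: sm smooth_on_minus open_W)+
  have smb: "smooth_on W (b i)" for i
    unfolding b_def by (intro smooth_on_add smooth_on_scaleR smooth_on_const open_W sma smc)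
  have indep: "wedge (a z) (c z) \<noteq> 0" if "z \<in> W" for z
    using frac that by (auto simp: fractional_linear_integral_def wedge_def a_def c_def algebra_simps)
  have wb: "wedge (b i z) (b j z) = (real j - real i) * wedge (a z) (c z)" for i j z
    by (simp add: b_def wedge_def algebra_simps)
  have "\<exists>\<F>. foliation W \<F> \<and> (\<forall>L\<in>\<F>. geodesic_leaf g L) \<and>
    (\<forall>z\<in>W. \<forall>v\<in>leaf_tangent \<F> z. \<exists>k. v = k *\<^sub>R sharp z (b i z))" for i
  proof (rule pencil_foliation[OF assms(2,3) smb smc])
    show "wedge (b i z) (c z) \<noteq> 0" if "z \<in> W" for z
    proof -
      have "wedge (b i z) (c z) = wedge (a z) (c z)"
        by (simp add: b_def wedge_def algebra_simps)
      then show ?thesis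
        using indep[OF that] by simp
    qed
    show "curl_defect (\<lambda>z. b i z + r *\<^sub>R c z) z = 0" if "z \<in> W" for z r
    proof -
      have "(\<lambda>z. b i z + r *\<^sub>R c z) = (\<lambda>z. vector [- B z, A z] + (real i + r) *\<^sub>R vector [- E z, C z])"
        by (simp add: b_def a_def c_def fun_eq_iff scaleR_add_left)
      then show ?thesis
        using integral_pencil[OF frac that] by simp
    qed
  qed
  then have "\<forall>i. \<exists>\<F>. foliation W \<F> \<and> (\<forall>L\<in>\<F>. geodesic_leaf g L) \<and>
    (\<forall>z\<in>W. \<forall>v\<in>leaf_tangent \<F> z. \<exists>k. v = k *\<^sub>R sharp z (b i z))"
    by (rule allI)
  then obtain \<F> where F: "\<forall>i. foliation W (\<F> i) \<and> (\<forall>L\<in>\<F> i. geodesic_leaf g L) \<and>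
    (\<forall>z\<in>W. \<forall>v\<in>leaf_tangent (\<F> i) z. \<exists>k. v = k *\<^sub>R sharp z (b i z))"
    by (rule choice[THEN exE])
  then have fol: "foliation W (\<F> i)" and geo: "L \<in> \<F> i \<Longrightarrow> geodesic_leaf g L"
    and span: "z \<in> W \<Longrightarrow> v \<in> leaf_tangent (\<F> i) z \<Longrightarrow> \<exists>k. v = k *\<^sub>R sharp z (b i z)" for i L z v
    by simp_all
  have ws: "wedge (sharp z (b i z)) (sharp z (b j z)) = (real j - real i) * (wedge (a z) (c z) / gdet z)"
    if "z \<in> W" for i j z
    using wedge_sharp[OF that, of "b i z" "b j z"] gdet_pos[OF that] by (simp add: wb field_simps)
  have ne: "wedge (a z) (c z) / gdet z \<noteq> 0" if "z \<in> W" for z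
    using indep[OF that] gdet_pos[OF that] by simp
  have "leaf_tangent (\<F> i) z \<inter> leaf_tangent (\<F> j) z = {0}" if z: "z \<in> W" and ij: "i \<noteq> j" for z i j
  proof (intro equalityI subsetI)
    fix v assume v: "v \<in> leaf_tangent (\<F> i) z \<inter> leaf_tangent (\<F> j) z"
    obtain k where k: "v = k *\<^sub>R sharp z (b i z)"
      using span[OF z IntD1[OF v]] by (rule exE)
    obtain l where l: "v = l *\<^sub>R sharp z (b j z)"
      using span[OF z IntD2[OF v]] by (rule exE)
    have "wedge v v = k * l * wedge (sharp z (b i z)) (sharp z (b j z))"
      by (subst (1) k, subst l) (simp add: wedge_def algebra_simps)
    then have "k * l = 0"
      using ne[OF z] ij by (simp add: ws[OF z] wedge_self)
    then show "v \<in> {0}"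
      using k l by auto
  next
    show "v \<in> leaf_tangent (\<F> i) z \<inter> leaf_tangent (\<F> j) z" if "v \<in> {0}" for v
      using that zero_in_leaf_tangent[OF fol z] by simp
  qed
  then have "four_web W \<F>"
    unfolding four_web_def using fol by simp
  moreover have "cross_ratio (v 1) (v 2) (v 3) (v 4) = 4 / 3"
    if z: "z \<in> W" and v: "\<forall>i\<in>{1..4}. v i \<in> leaf_tangent (\<F> i) z - {0}" for z v
  proof -
    have "\<exists>k. k \<noteq> 0 \<and> v i = k *\<^sub>R sharp z (b i z)" if "i \<in> {1..4}" for i
      using span[OF z, of "v i" i] v that by fastforce
    then obtain k where k: "\<And>i. i \<in> {1..4} \<Longrightarrow> k i \<noteq> 0 \<and> v i = k i *\<^sub>R sharp z (b i z)"
      by metis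
    define d where "d = wedge (a z) (c z) / gdet z"
    have "cross_ratio (v 1) (v 2) (v 3) (v 4) =
        cross_ratio (sharp z (b 1 z)) (sharp z (b 2 z)) (sharp z (b 3 z)) (sharp z (b 4 z))"
      using k by (simp add: cross_ratio_scale)
    also have "\<dots> = 4 / 3"
      using ne[OF z] unfolding cross_ratio_def ws[OF z] d_def[symmetric] by simp
    finally show ?thesis .
  qed
  ultimately have "nakai_web W \<F>"
    unfolding nakai_web_def by (intro conjI exI[of _ "4 / 3"] ballI allI impI)
  moreover have "geodesic_web g \<F>"
    unfolding geodesic_web_def by (intro ballI geo)
  ultimately show ?thesis
    by blast
qed

theorem theorem11:
  fixes S :: "'a topology" and \<A> :: "'a chart set"
    and g :: "'a chart \<Rightarrow> real^2 \<Rightarrow> real^2^2" and s\<^sub>0 :: 'a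
  assumes "smooth_surface S \<A>" and "riemannian_metric \<A> g" and "s\<^sub>0 \<in> topspace S"
  shows "has_fractional_linear_integral_near \<A> g s\<^sub>0 \<longleftrightarrow> has_geodesic_nakai_web_near \<A> g s\<^sub>0"
proof -
  have metric: "metric_domain W (g c)" if "c \<in> \<A>" "open W" "W \<subseteq> coords c" for c W
    using assms(2) that unfolding riemannian_metric_def metric_domain_def riemannian_metric_on_def
    by (auto intro: smooth_on_subset)
  show ?thesis
  proof
    assume "has_fractional_linear_integral_near \<A> g s\<^sub>0"
    then obtain c W A B C E where c: "c \<in> \<A>" and W: "coord_nbhd c s\<^sub>0 W"
      and frac: "fractional_linear_integral W (g c) A B C E"
      unfolding has_fractional_linear_integral_near_def by blast
    then obtain e where e: "e > 0" "ball (snd c s\<^sub>0) e \<subseteq> W"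
      unfolding coord_nbhd_def using open_contains_ball by blast
    define D where "D = ball (snd c s\<^sub>0) e"
    have D: "coord_nbhd c s\<^sub>0 D"
      using W e unfolding coord_nbhd_def D_def by auto
    interpret metric_domain D "g c"
      using D c by (intro metric) (auto simp: coord_nbhd_def)
    have "fractional_linear_integral D (g c) A B C E"
      using frac e(2) unfolding fractional_linear_integral_def D_def by (auto intro: smooth_on_subset)
    then have "\<exists>\<F>. nakai_web D \<F> \<and> geodesic_web (g c) \<F>"
      by (rule web_of_integral[where z\<^sub>0 = "snd c s\<^sub>0"]) (use e in \<open>simp_all add: D_def\<close>)
    then show "has_geodesic_nakai_web_near \<A> g s\<^sub>0"
      unfolding has_geodesic_nakai_web_near_def using c D by blast
  next
    assume "has_geodesic_nakai_web_near \<A> g s\<^sub>0"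
    then obtain c W \<F> where c: "c \<in> \<A>" and W: "coord_nbhd c s\<^sub>0 W"
      and web: "nakai_web W \<F>" "geodesic_web (g c) \<F>"
      unfolding has_geodesic_nakai_web_near_def by blast
    interpret metric_domain W "g c"
      using W c by (intro metric) (auto simp: coord_nbhd_def)
    obtain V A B C E where V: "open V" "snd c s\<^sub>0 \<in> V" "V \<subseteq> W" "fractional_linear_integral V (g c) A B C E"
      using integral_of_web[OF web, of "snd c s\<^sub>0"] W unfolding coord_nbhd_def by blast
    then have "coord_nbhd c s\<^sub>0 V"
      using W unfolding coord_nbhd_def by auto
    then show "has_fractional_linear_integral_near \<A> g s\<^sub>0"
      unfolding has_fractional_linear_integral_near_def using c V(4) by blast
  qed
qed

end
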